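(* Let $Q_4(s,k)=18-45k+36k^2-9k^3-34s^2+18s^2k-3s^4$ and $\mathcal D_4=\{(s,k)\in\mathbb{R}^2:\ Q_4(s,k)>0,\ k>1\}$. The support of $(S_4,K_4)$ is the closure of $\mathcal D_4$, and the density of $(S_4,K_4)$ is $$h_4(s,k)=\frac{3}{2\pi\,Q_4(s,k)^{1/2}},\qquad (s,k)\in\mathcal D_4 .$$
   Context: $S_4$ and $K_4$ are the sample skewness and kurtosis of four independent $N(\mu,\sigma^2)$ observations $X_1,\dots,X_4$ ($\sigma>0$): with $m_r=\frac14\sum_{i=1}^4(X_i-\bar X)^r$, $S_4=m_3/m_2^{3/2}$ and $K_4=m_4/m_2^2$. Equivalently $(S_4,K_4)=(2\sum_iU_i^3,\;4\sum_iU_i^4)$ with $U$ uniformly distributed on the sphere $\{u\in\mathbb{R}^4:\sum_iu_i=0,\ \sum_iu_i^2=1\}$. *)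

theory Defs
  imports "HOL-Probability.Probability"
begin

definition sample_mean :: "nat \<Rightarrow> (nat \<Rightarrow> real) \<Rightarrow> real" where
  "sample_mean n x = (\<Sum>i=1..n. x i) / real n"

definition sample_central_moment :: "nat \<Rightarrow> nat \<Rightarrow> (nat \<Rightarrow> real) \<Rightarrow> real" where
  "sample_central_moment n r x = (\<Sum>i=1..n. (x i - sample_mean n x) ^ r) / real n"

(* On a constant sample (a null event for a normal sample) the second central moment
   vanishes and both statistics take the value 0. *)

definition sample_skewness :: "nat \<Rightarrow> (nat \<Rightarrow> real) \<Rightarrow> real" where
  "sample_skewness n x = sample_central_moment n 3 x / (sample_central_moment n 2 x) powr (3/2)"

definition sample_kurtosis :: "nat \<Rightarrow> (nat \<Rightarrow> real) \<Rightarrow> real" where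
  "sample_kurtosis n x = sample_central_moment n 4 x / (sample_central_moment n 2 x)\<^sup>2"

(* Topological support of a Borel measure; for a separable metric space this is the
   smallest closed set whose complement is null. *)
definition measure_support :: "'b::topological_space measure \<Rightarrow> 'b set" where
  "measure_support N = {x. \<forall>U. open U \<and> x \<in> U \<longrightarrow> emeasure N U > 0}"

definition Q4 :: "real \<Rightarrow> real \<Rightarrow> real" where
  "Q4 s k = 18 - 45 * k + 36 * k^2 - 9 * k^3 - 34 * s^2 + 18 * s^2 * k - 3 * s^4"

definition D4 :: "(real \<times> real) set" where
  "D4 = {(s, k). Q4 s k > 0 \<and> k > 1}"

definition h4 :: "real \<times> real \<Rightarrow> real" where
  "h4 = (\<lambda>(s, k). if (s, k) \<in> D4 then 3 / (2 * pi * sqrt (Q4 s k)) else 0)"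

end

theory Submission
  imports Defs
begin

text \<open>
  Multiplying the sample by half the Hadamard matrix of order 4 gives coordinates \<open>(m, a, b, c)\<close> in which
  the mean is \<open>m / 2\<close> and, for a normal sample, \<open>m\<close> is independent of an isotropic normal vector
  \<open>(a, b, c)\<close>. In these coordinates the shape of the sample is governed by only three polynomials,
  \<open>t = a\<^sup>2 + b\<^sup>2 + c\<^sup>2\<close>, \<open>p = abc\<close> and \<open>q = a\<^sup>2b\<^sup>2 + b\<^sup>2c\<^sup>2 + c\<^sup>2a\<^sup>2\<close>, namely \<open>S = 6p / t\<^sup>3\<^sup>/\<^sup>2\<close> and
  \<open>K = 1 + 4q / t\<^sup>2\<close> (\<open>sample_shape_in_Hadamard_coordinates\<close>).

  Consequently \<open>a\<^sup>2/t\<close>, \<open>b\<^sup>2/t\<close>, \<open>c\<^sup>2/t\<close> are the roots of the cubic \<open>X\<^sup>3 - X\<^sup>2 + (K - 1)/4 X - S\<^sup>2/36\<close>, and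
  \<open>Q\<^sub>4(S, K)\<close> is 144 times its discriminant (\<open>Q4_eq_cubic_disc\<close>). The set \<open>D\<^sub>4\<close> consists of the parameters
  for which this cubic has three distinct nonnegative roots; these are exactly the values that
  occur away from the null set where two of \<open>\<bar>a\<bar>\<close>, \<open>\<bar>b\<bar>\<close>, \<open>\<bar>c\<bar>\<close> agree (\<open>real_roots_of_cubic\<close>,
  \<open>invariants_image\<close>).

  The 24 permutations of the sample act on \<open>(a, b, c)\<close> by permutations and even sign changes, and
  \<open>(t, p, q)\<close> are the basic invariants of this reflection group. On the chamber \<open>a > b > \<bar>c\<bar>\<close> they are
  coordinates, with Jacobian up to sign four times the Vandermonde product of the squares, which is four times
  the square root of the discriminant. Folding the Gaussian integral into this chamber
  (\<open>nn_integral_tetrahedral_symmetry\<close>) and changing variables (\<open>nn_integral_invariants\<close>) therefore puts the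
  inverse square root of the discriminant into the density. Since the discriminant is homogeneous,
  rescaling \<open>(p, q)\<close> to \<open>(S, K)\<close> at fixed \<open>t\<close> separates the variables, and the remaining integral over \<open>t\<close> is
  \<open>\<Gamma>(3/2)\<close> up to scaling, which yields the constant \<open>3 / (2\<pi>)\<close> (\<open>nn_integral_isotropic_shape\<close>). The support
  is the closure of \<open>D\<^sub>4\<close> because \<open>D\<^sub>4\<close> is open and the density is positive precisely there.
\<close>

section \<open>Change of variables for nonnegative integrals\<close>

text \<open>Bridges the two integrals in play: the change-of-variables theorem speaks of the
  Henstock-Kurzweil integral, whereas the laws of random variables are \<open>nn_integral\<close>s.\<close>

lemma nonneg_set_integral_iff_nn_integral:
  fixes H :: "'a::euclidean_space \<Rightarrow> real"
  assumes [measurable]: "H \<in> borel_measurable borel" "T \<in> sets borel" and nonneg: "\<And>x. 0 \<le> H x"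
  shows "H absolutely_integrable_on T \<and> integral T H = b \<longleftrightarrow>
         (\<integral>\<^sup>+x. indicator T x * ennreal (H x) \<partial>lborel) = ennreal b \<and> 0 \<le> b"
proof -
  have "H absolutely_integrable_on T \<and> integral T H = b \<longleftrightarrow> (H has_integral b) T"
    using nonneg nonnegative_absolutely_integrable_1[of H T]
    by (auto simp: has_integral_iff absolutely_integrable_on_def)
  also have "\<dots> \<longleftrightarrow> ((\<lambda>x. indicator T x * H x) has_integral b) UNIV"
  proof -
    have "(\<lambda>x. indicator T x * H x) = (\<lambda>x. if x \<in> T then H x else 0)"
      by (auto simp: fun_eq_iff)
    then show ?thesis by (simp only: has_integral_restrict_UNIV)
  qed
  also have "\<dots> \<longleftrightarrow> (\<integral>\<^sup>+x. ennreal (indicator T x * H x) \<partial>lborel) = ennreal b \<and> 0 \<le> b"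
    by (subst has_integral_iff_nn_integral_lebesgue) (auto simp: nonneg nn_integral_completion intro!: measurable_completion)
  also have "(\<integral>\<^sup>+x. ennreal (indicator T x * H x) \<partial>lborel) = (\<integral>\<^sup>+x. indicator T x * ennreal (H x) \<partial>lborel)"
    by (intro nn_integral_cong) (auto simp: indicator_def)
  finally show ?thesis .
qed

text \<open>A nonnegative function has a well-defined, possibly infinite, integral, so no integrability
  is assumed: if either side is finite, the theorem on absolutely integrable functions transfers the
  value to the other side, and otherwise both sides are infinite.\<close>

lemma nn_integral_change_of_variables:
  fixes g :: "real^'m::{finite,wellorder} \<Rightarrow> real^'m::_" and F :: "real^'m::_ \<Rightarrow> real"
  assumes S [measurable]: "S \<in> sets borel" and gS [measurable]: "g ` S \<in> sets borel"
    and der: "\<And>x. x \<in> S \<Longrightarrow> (g has_derivative g' x) (at x within S)"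
    and inj: "inj_on g S"
    and F [measurable]: "F \<in> borel_measurable borel" and nonneg: "\<And>y. 0 \<le> F y"
    and L: "(\<lambda>x. \<bar>det (matrix (g' x))\<bar> * F (g x)) \<in> borel_measurable borel"
  shows "(\<integral>\<^sup>+x. indicator S x * ennreal (\<bar>det (matrix (g' x))\<bar> * F (g x)) \<partial>lborel) =
         (\<integral>\<^sup>+y. indicator (g ` S) y * ennreal (F y) \<partial>lborel)" (is "?I = ?J")
proof -
  let ?L = "\<lambda>x. \<bar>det (matrix (g' x))\<bar> * F (g x)"
  have cov: "?L absolutely_integrable_on S \<and> integral S ?L = b \<longleftrightarrow>
        F absolutely_integrable_on g ` S \<and> integral (g ` S) F = b" for b
  proof -
    have "S \<in> sets lebesgue" using S by simp
    from has_absolute_integral_change_of_variables[OF this der inj, of "\<lambda>y. vec (F y) :: real^1" "vec b"]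
    show ?thesis
      unfolding absolutely_integrable_on_1_iff integral_on_1_eq
      by (auto simp: vec_eq_iff)
  qed
  have iff: "(?I = ennreal b \<and> 0 \<le> b) \<longleftrightarrow> (?J = ennreal b \<and> 0 \<le> b)" for b
    using cov[of b] nonneg_set_integral_iff_nn_integral[of ?L S b]
      nonneg_set_integral_iff_nn_integral[of F "g ` S" b] L nonneg by simp
  show ?thesis
    using iff[of "enn2real ?I"] iff[of "enn2real ?J"]
    by (cases ?I; cases ?J) auto
qed

section \<open>Cubics with three real roots\<close>

text \<open>The discriminant of \<open>X\<^sup>3 - t X\<^sup>2 + q X - r\<close>.\<close>

definition cubic_disc :: "real \<Rightarrow> real \<Rightarrow> real \<Rightarrow> real" where
  "cubic_disc t q r = t^2 * q^2 - 4 * q^3 - 4 * t^3 * r + 18 * t * q * r - 27 * r^2"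

lemma cubic_disc_roots:
  "cubic_disc (x + y + z) (x*y + y*z + z*x) (x*y*z) = ((x - y) * (y - z) * (x - z))^2"
  unfolding cubic_disc_def by algebra

text \<open>Scaling the roots by \<open>t\<close> scales each of the three squared root differences by \<open>t\<^sup>2\<close>.\<close>

lemma cubic_disc_scale: "cubic_disc t (t^2 * q) (t^3 * r) = t^6 * cubic_disc 1 q r"
  by (simp add: cubic_disc_def algebra_simps eval_nat_numeral)

text \<open>The reason for the shape of \<open>Q\<^sub>4\<close>: it is the discriminant of the cubic whose roots are the
  squares of the normalised Hadamard coordinates of the sample.\<close>

lemma Q4_eq_cubic_disc: "Q4 s k = 144 * cubic_disc 1 ((k - 1) / 4) (s^2 / 36)"
  by (simp add: Q4_def cubic_disc_def power2_eq_square power3_eq_cube power4_eq_xxxx field_simps)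

text \<open>The identity \<open>27 disc = 4 (t\<^sup>2 - 3q)\<^sup>3 - B\<^sup>2\<close> with \<open>B = 2t\<^sup>3 - 9tq + 27r\<close> says that a positive
  discriminant forces the two critical values of the cubic to have opposite signs. Both critical points
  are positive and the cubic is nonpositive at 0, so the intermediate value theorem yields the two
  smaller roots in \<open>[0, \<infinity>)\<close>.\<close>

lemma real_roots_of_cubic:
  assumes t: "t > 0" and q: "q > 0" and r: "r \<ge> 0" and disc: "cubic_disc t q r > 0"
  obtains x y z where "x > y" "y > z" "z \<ge> 0" "x + y + z = t" "x*y + y*z + z*x = q" "x*y*z = r"
proof -
  define f where "f X = X^3 - t*X^2 + q*X - r" for X
  define d where "d = t^2 - 3*q"
  define B where "B = 2*t^3 - 9*t*q + 27*r"
  have disc_eq: "27 * cubic_disc t q r = 4*d^3 - B^2"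
    unfolding cubic_disc_def d_def B_def by algebra
  then have B2: "B^2 < 4*d^3" using disc by simp
  \<comment> \<open>\<open>d\<close> is a quarter of the discriminant of \<open>f'\<close>, so \<open>f\<close> has two critical points.\<close>
  have "d > 0"
  proof (rule ccontr)
    assume "\<not> d > 0"
    then have "d^3 \<le> 0" by (simp add: power3_eq_cube mult_nonneg_nonpos mult_nonpos_nonpos)
    with B2 show False using zero_le_power2[of B] by linarith
  qed
  define w where "w = sqrt d"
  have w: "w > 0" "w^2 = d" using \<open>d > 0\<close> by (auto simp: w_def)
  have "w < t"
    by (rule power2_less_imp_less) (use w q t in \<open>auto simp: d_def\<close>)
  have "B^2 < (2*w^3)^2"
  proof -
    have "(2*w^3)^2 = 4*(w^2)^3" by algebra
    then show ?thesis using B2 w(2) by simp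
  qed
  then have Bw: "\<bar>B\<bar> < 2*w^3"
    using w(1) by (metis abs_of_pos abs_square_less_1 mult_pos_pos power2_abs power2_less_imp_less
        zero_less_numeral zero_less_power less_imp_le)
  \<comment> \<open>The critical points of \<open>f\<close>; its critical values turn out to be \<open>(\<plusminus> 2 w\<^sup>3 - B) / 27\<close>.\<close>
  define u v where "u = (t - w)/3" and "v = (t + w)/3"
  have fu: "27 * f u = 2*w^3 - B"
  proof -
    have "3 * u = t - w" by (simp add: u_def)
    then show ?thesis using w(2) unfolding f_def B_def d_def by algebra
  qed
  have fv: "27 * f v = - (2*w^3) - B"
  proof -
    have "3 * v = t + w" by (simp add: v_def)
    then show ?thesis using w(2) unfolding f_def B_def d_def by algebra
  qed
  have signs: "f u > 0" "f v < 0" "f 0 \<le> 0" "0 < u" "u < v"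
    using fu fv Bw \<open>w < t\<close> w(1) r by (auto simp: u_def v_def f_def)
  have cont: "continuous_on A f" for A unfolding f_def by (intro continuous_intros)
  obtain z where z: "0 \<le> z" "z \<le> u" "f z = 0"
    using IVT'[of f 0 0 u] signs cont by auto
  obtain y where y: "u \<le> y" "y \<le> v" "f y = 0"
    using IVT2'[of f v 0 u] signs cont by auto
  have zy: "z < u" "u < y" "y < v"
    using z y signs by (auto simp: less_le)
  \<comment> \<open>The third root is read off from the sum of the roots.\<close>
  define x where "x = t - y - z"
  have "(y - z) * (y^2 + y*z + z^2 - t*(y + z) + q) = 0"
    using y(3) z(3) unfolding f_def by algebra
  then have "y^2 + y*z + z^2 - t*(y + z) + q = 0"
    using zy by simp
  then have qq: "q = x*y + y*z + z*x"
    unfolding x_def by algebra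
  have rr: "x*y*z = r"
    using z(3) qq unfolding f_def x_def by algebra
  have "f v = (v - x) * ((v - y) * (v - z))"
    using qq rr unfolding f_def x_def by algebra
  moreover have "(v - y) * (v - z) > 0" using zy by simp
  ultimately have "v < x"
    using signs(2) zy by (metis diff_less_0_iff_less mult_less_0_iff order_less_asym)
  then have "x > y" "y > z" using zy by simp_all
  moreover have "x + y + z = t" by (simp add: x_def)
  ultimately show ?thesis using that z(1) qq rr by metis
qed

text \<open>Equal elementary symmetric functions make \<open>(X - x)(X - y)(X - z)\<close> and
  \<open>(X - x')(X - y')(X - z')\<close> the same polynomial.\<close>

lemma ordered_roots_unique:
  fixes x y z x' y' z' :: real
  assumes "x > y" "y > z" "x' > y'" "y' > z'" "x + y + z = x' + y' + z'"
    "x*y + y*z + z*x = x'*y' + y'*z' + z'*x'" "x*y*z = x'*y'*z'"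
  shows "x = x' \<and> y = y' \<and> z = z'"
proof -
  have *: "(X - x) * (X - y) * (X - z) = (X - x') * (X - y') * (X - z')" for X
    using assms(5-7) by algebra
  have "x' = x \<or> x' = y \<or> x' = z" "y' = x \<or> y' = y \<or> y' = z" "z' = x \<or> z' = y \<or> z' = z"
    using *[of x'] *[of y'] *[of z'] by auto
  then show ?thesis using assms(1-4) by auto
qed

section \<open>Sample moments in Hadamard coordinates\<close>

lemma sum_1_4: "(\<Sum>i=1..4. f i) = f 1 + f 2 + f 3 + (f 4 :: real)" for f :: "nat \<Rightarrow> real"
  by (simp add: eval_nat_numeral atLeastAtMostSuc_conv)

text \<open>The Hadamard matrix of order 4, divided by 2, is orthogonal, and its first row spans the constant
  samples: \<open>m\<close> carries the mean and \<open>(a, b, c)\<close> the deviations from it.\<close>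

lemma sample_mean_Hadamard: 
  assumes "x 1 = (m+a+b+c)/2" "x 2 = (m+a-b-c)/2" "x 3 = (m-a+b-c)/2" "x 4 = (m-a-b+c)/2"
  shows "sample_mean 4 x = m/2"
  unfolding sample_mean_def sum_1_4 assms by (simp add: field_simps)

text \<open>The deviations \<open>(\<plusminus>a \<plusminus> b \<plusminus> c) / 2\<close> run over the sign patterns with an even number of minus signs.
  Summing over them kills every monomial that is neither even in each variable nor odd in each
  variable, so that only symmetric functions of the squares and \<open>abc\<close> survive.\<close>

lemma sample_central_moments_Hadamard:
  assumes "x 1 = (m+a+b+c)/2" "x 2 = (m+a-b-c)/2" "x 3 = (m-a+b-c)/2" "x 4 = (m-a-b+c)/2"
  shows "sample_central_moment 4 2 x = (a^2 + b^2 + c^2) / 4"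
    and "sample_central_moment 4 3 x = 3 * (a*b*c) / 4"
    and "sample_central_moment 4 4 x =
           ((a^2 + b^2 + c^2)^2 + 4 * (a^2*b^2 + b^2*c^2 + c^2*a^2)) / 16"
proof -
  have d: "x 1 - m/2 = (a+b+c)/2" "x 2 - m/2 = (a-b-c)/2" "x 3 - m/2 = (b-a-c)/2" "x 4 - m/2 = (c-a-b)/2"
    unfolding assms by (simp_all add: field_simps)
  show "sample_central_moment 4 2 x = (a^2 + b^2 + c^2) / 4"
    "sample_central_moment 4 3 x = 3 * (a*b*c) / 4"
    "sample_central_moment 4 4 x =
           ((a^2 + b^2 + c^2)^2 + 4 * (a^2*b^2 + b^2*c^2 + c^2*a^2)) / 16"
    unfolding sample_central_moment_def sum_1_4 sample_mean_Hadamard[OF assms] d power_divide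
    by (simp_all add: field_simps power2_eq_square power3_eq_cube power4_eq_xxxx)
qed

lemma sample_skewness_Hadamard:
  assumes "x 1 = (m+a+b+c)/2" "x 2 = (m+a-b-c)/2" "x 3 = (m-a+b-c)/2" "x 4 = (m-a-b+c)/2"
  shows "sample_skewness 4 x = 6 * (a*b*c) / (a^2 + b^2 + c^2) powr (3/2)"
proof -
  have "(4::real) powr (3/2) = 8"
  proof -
    have "(4::real) powr (3/2) = (2 powr 2) powr (3/2)" by simp
    also have "\<dots> = 2 powr 3" by (subst powr_powr) simp
    finally show ?thesis by simp
  qed
  then show ?thesis
    unfolding sample_skewness_def sample_central_moments_Hadamard[OF assms]
    by (subst powr_divide) (auto simp: field_simps)
qed

text \<open>The quotient is not split into \<open>1 + 4q / t\<^sup>2\<close>: in this form the formula also holds for a constant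
  sample, where both sides are 0.\<close>

lemma sample_kurtosis_Hadamard:
  assumes "x 1 = (m+a+b+c)/2" "x 2 = (m+a-b-c)/2" "x 3 = (m-a+b-c)/2" "x 4 = (m-a-b+c)/2"
  shows "sample_kurtosis 4 x =
    ((a^2 + b^2 + c^2)^2 + 4 * (a^2*b^2 + b^2*c^2 + c^2*a^2)) / (a^2 + b^2 + c^2)^2"
proof -
  have "(N / 16) / (T / 4)^2 = N / T^2" for N T :: real
    by (simp add: power_divide)
  then show ?thesis
    unfolding sample_kurtosis_def sample_central_moments_Hadamard[OF assms] .
qed

text \<open>The inverse Hadamard transform is the transform itself, the matrix being symmetric and
  orthogonal.\<close>

lemma sample_shape_in_Hadamard_coordinates:
  fixes x :: "nat \<Rightarrow> real"
  defines "a \<equiv> (x 1 + x 2 - x 3 - x 4) / 2" and "b \<equiv> (x 1 - x 2 + x 3 - x 4) / 2"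
    and "c \<equiv> (x 1 - x 2 - x 3 + x 4) / 2"
  shows "sample_skewness 4 x = 6 * (a*b*c) / (a^2 + b^2 + c^2) powr (3/2)"
    and "sample_kurtosis 4 x =
      ((a^2 + b^2 + c^2)^2 + 4 * (a^2*b^2 + b^2*c^2 + c^2*a^2)) / (a^2 + b^2 + c^2)^2"
proof -
  define m where "m = (x 1 + x 2 + x 3 + x 4) / 2"
  have x: "x 1 = (m+a+b+c)/2" "x 2 = (m+a-b-c)/2" "x 3 = (m-a+b-c)/2" "x 4 = (m-a-b+c)/2"
    unfolding m_def a_def b_def c_def by (simp_all add: field_simps)
  show "sample_skewness 4 x = 6 * (a*b*c) / (a^2 + b^2 + c^2) powr (3/2)"
    using sample_skewness_Hadamard[OF x] .
  show "sample_kurtosis 4 x =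
      ((a^2 + b^2 + c^2)^2 + 4 * (a^2*b^2 + b^2*c^2 + c^2*a^2)) / (a^2 + b^2 + c^2)^2"
    using sample_kurtosis_Hadamard[OF x] .
qed

section \<open>Lebesgue measure in three dimensions\<close>

lemma Basis_real3: "(Basis :: (real^3) set) = {axis 1 1, axis 2 1, axis 3 1}"
  by (auto simp: Basis_vec_def) (metis exhaust_3)

lemma prod_Basis_real3: "(\<Prod>b\<in>(Basis :: (real^3) set). v \<bullet> b) = v$1 * v$2 * v$3"
  unfolding Basis_real3 by (simp add: axis_eq_axis inner_axis mult.assoc)

lemma Basis_triple: "(Basis :: (real \<times> real \<times> real) set) = {(1,0,0), (0,1,0), (0,0,1)}"
  by (auto simp: Basis_prod_def zero_prod_def)

lemma prod_Basis_triple: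
  "(\<Prod>b\<in>(Basis :: (real \<times> real \<times> real) set). v \<bullet> b) = fst v * fst (snd v) * snd (snd v)"
  unfolding Basis_triple by (cases v) (simp add: mult.assoc)

lemma emeasure_lborel_box_triple:
  fixes l1 l2 l3 u1 u2 u3 :: real
  assumes "l1 \<le> u1" "l2 \<le> u2" "l3 \<le> u3"
  shows "emeasure lborel (box (l1,l2,l3) (u1,u2,u3)) = ennreal ((u1 - l1) * (u2 - l2) * (u3 - l3))"
proof -
  have "emeasure lborel (box (l1,l2,l3) (u1,u2,u3)) = ennreal (\<Prod>b\<in>Basis. ((u1,u2,u3) - (l1,l2,l3)) \<bullet> b)"
    by (rule emeasure_lborel_box) (use assms in \<open>auto simp: Basis_prod_def\<close>)
  then show ?thesis unfolding prod_Basis_triple by simp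
qed

lemma mem_box_triple:
  fixes a b c l1 l2 l3 u1 u2 u3 :: real
  shows "(a,b,c) \<in> box (l1,l2,l3) (u1,u2,u3) \<longleftrightarrow> l1 < a \<and> a < u1 \<and> l2 < b \<and> b < u2 \<and> l3 < c \<and> c < u3"
  unfolding mem_box Basis_triple by auto

lemma measurable_vector3 [measurable (raw)]:
  fixes f g h :: "'a \<Rightarrow> real"
  assumes [measurable]: "f \<in> borel_measurable M" "g \<in> borel_measurable M" "h \<in> borel_measurable M"
  shows "(\<lambda>x. vector [f x, g x, h x] :: real^3) \<in> borel_measurable M"
  by (subst borel_measurable_euclidean_space) (auto simp: Basis_real3 inner_axis)

lemma measurable_vec_nth [measurable (raw)]:
  fixes f :: "'a \<Rightarrow> real^'n"
  assumes [measurable]: "f \<in> borel_measurable M"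
  shows "(\<lambda>x. f x $ i) \<in> borel_measurable M"
  using assms by (auto intro!: borel_measurable_continuous_on[where f="\<lambda>v. v $ i"] continuous_intros)

lemma nn_integral_triple:
  fixes f :: "real \<Rightarrow> real \<Rightarrow> real \<Rightarrow> ennreal"
  assumes [measurable]: "(\<lambda>(a,b,c). f a b c) \<in> borel_measurable borel"
  shows "(\<integral>\<^sup>+z. f (fst z) (fst (snd z)) (snd (snd z)) \<partial>lborel) = (\<integral>\<^sup>+a. \<integral>\<^sup>+b. \<integral>\<^sup>+c. f a b c \<partial>lborel \<partial>lborel \<partial>lborel)"
proof -
  note m [measurable] = assms[folded borel_prod]
  let ?f = "\<lambda>z. f (fst z) (fst (snd z)) (snd (snd z))"
  have mf: "?f \<in> borel_measurable (borel \<Otimes>\<^sub>M (borel \<Otimes>\<^sub>M borel))"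
    using m by (simp add: case_prod_beta')
  have "(\<integral>\<^sup>+z. ?f z \<partial>(lborel \<Otimes>\<^sub>M lborel)) = (\<integral>\<^sup>+a. \<integral>\<^sup>+w. ?f (a, w) \<partial>lborel \<partial>lborel)"
    by (rule lborel.nn_integral_fst[symmetric]) (use mf in \<open>simp add: borel_prod lborel_prod\<close>)
  moreover have "(\<integral>\<^sup>+w. ?f (a, w) \<partial>(lborel \<Otimes>\<^sub>M lborel)) = (\<integral>\<^sup>+b. \<integral>\<^sup>+c. ?f (a, (b, c)) \<partial>lborel \<partial>lborel)" for a
    by (rule lborel.nn_integral_fst[symmetric]) (use measurable_Pair2[OF mf, of a] in \<open>simp add: borel_prod lborel_prod\<close>)
  ultimately show ?thesis
    by (simp add: lborel_prod)
qed

text \<open>The change of variables takes place in \<^typ>\<open>real^3\<close>, Fubini's theorem in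
  \<^typ>\<open>real \<times> real \<times> real\<close>; this identifies the two Lebesgue measures.\<close>

lemma lborel_real3: "(lborel :: (real^3) measure) = distr lborel borel (\<lambda>(a,b,c). vector [a,b,c])"
proof (rule lborel_eqI)
  fix l u :: "real^3" assume le: "\<And>b. b \<in> Basis \<Longrightarrow> l \<bullet> b \<le> u \<bullet> b"
  have le3: "l$1 \<le> u$1" "l$2 \<le> u$2" "l$3 \<le> u$3"
    using le[of "axis 1 1"] le[of "axis 2 1"] le[of "axis 3 1"] by (simp_all add: Basis_real3 inner_axis)
  have [measurable]: "(\<lambda>(a,b,c). vector [a,b,c] :: real^3) \<in> borel_measurable lborel"
    unfolding borel_prod[symmetric] lborel_prod[symmetric] by measurable
  have "(\<lambda>(a,b,c). vector [a,b,c]) -` box l u = box (l$1, l$2, l$3) (u$1, u$2, u$3)"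
    by (auto simp: mem_box Basis_real3 inner_axis Basis_prod_def)
  then have "emeasure (distr lborel borel (\<lambda>(a,b,c). vector [a,b,c])) (box l u)
      = emeasure lborel (box (l$1, l$2, l$3) (u$1, u$2, u$3))"
    by (subst emeasure_distr) auto
  also have "\<dots> = ennreal ((u$1 - l$1) * (u$2 - l$2) * (u$3 - l$3))"
    using le3 by (rule emeasure_lborel_box_triple)
  also have "\<dots> = ennreal (\<Prod>b\<in>Basis. (u - l) \<bullet> b)"
    unfolding prod_Basis_real3 by simp
  finally show "emeasure (distr lborel borel (\<lambda>(a,b,c). vector [a,b,c])) (box l u)
      = ennreal (\<Prod>b\<in>Basis. (u - l) \<bullet> b)" .
qed simp

lemma nn_integral_real3:
  fixes f :: "real^3 \<Rightarrow> ennreal"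
  assumes [measurable]: "f \<in> borel_measurable borel"
  shows "(\<integral>\<^sup>+v. f v \<partial>lborel) = (\<integral>\<^sup>+a. \<integral>\<^sup>+b. \<integral>\<^sup>+c. f (vector [a,b,c]) \<partial>lborel \<partial>lborel \<partial>lborel)"
proof -
  have m [measurable]: "(\<lambda>(a,b,c). vector [a,b,c] :: real^3) \<in> borel_measurable borel"
    unfolding borel_prod[symmetric] by measurable
  have "(\<integral>\<^sup>+v. f v \<partial>lborel) = (\<integral>\<^sup>+z. f (case z of (a,b,c) \<Rightarrow> vector [a,b,c]) \<partial>lborel)"
    by (subst lborel_real3) (simp add: nn_integral_distr)
  also have "\<dots> = (\<integral>\<^sup>+z. f (vector [fst z, fst (snd z), snd (snd z)]) \<partial>lborel)"
    by (simp add: case_prod_beta)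
  also have "\<dots> = (\<integral>\<^sup>+a. \<integral>\<^sup>+b. \<integral>\<^sup>+c. f (vector [a,b,c]) \<partial>lborel \<partial>lborel \<partial>lborel)"
    by (rule nn_integral_triple) (unfold borel_prod[symmetric], measurable)
  finally show ?thesis .
qed

section \<open>The invariants as coordinates on a chamber\<close>

text \<open>A fundamental domain for the group of permutations and even sign changes of three coordinates,
  the Weyl group of type \<open>D\<^sub>3\<close>. In terms of the sample it is the region \<open>x\<^sub>1 > x\<^sub>2 > x\<^sub>3 > x\<^sub>4\<close>.\<close>

definition weyl_chamber :: "(real^3) set" where
  "weyl_chamber = {v. v$1 > v$2 \<and> v$2 > \<bar>v$3\<bar>}"

text \<open>Coordinates are \<open>(t, p, q)\<close>, and \<open>p\<close> enters the cubic through its square.\<close>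

definition real_rooted_set :: "(real^3) set" where
  "real_rooted_set = {y. y$1 > 0 \<and> y$3 > 0 \<and> cubic_disc (y$1) (y$3) ((y$2)^2) > 0}"

text \<open>The basic invariants of the same group.\<close>

definition invariants :: "real^3 \<Rightarrow> real^3" where
  "invariants v = vector [(v$1)^2 + (v$2)^2 + (v$3)^2, v$1 * v$2 * v$3,
     (v$1)^2 * (v$2)^2 + (v$2)^2 * (v$3)^2 + (v$3)^2 * (v$1)^2]"

definition invariants_deriv :: "real^3 \<Rightarrow> real^3 \<Rightarrow> real^3" where
  "invariants_deriv v h = vector [2 * v$1 * h$1 + 2 * v$2 * h$2 + 2 * v$3 * h$3,
     v$2 * v$3 * h$1 + v$3 * v$1 * h$2 + v$1 * v$2 * h$3,
     2 * v$1 * ((v$2)^2 + (v$3)^2) * h$1 + 2 * v$2 * ((v$3)^2 + (v$1)^2) * h$2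
       + 2 * v$3 * ((v$1)^2 + (v$2)^2) * h$3]"

lemma has_derivative_invariants: "(invariants has_derivative invariants_deriv v) (at v within S)"
proof -
  have D: "((\<lambda>v. v $ i) has_derivative (\<lambda>h. h $ i)) (at v within S)" for i :: 3
    by (rule bounded_linear_imp_has_derivative) (rule bounded_linear_vec_nth)
  show ?thesis
  proof (subst has_derivative_componentwise_within, rule ballI)
    fix i :: "real^3" assume "i \<in> Basis"
    then consider "i = axis 1 1" | "i = axis 2 1" | "i = axis 3 1" by (auto simp: Basis_real3)
    then show "((\<lambda>x. invariants x \<bullet> i) has_derivative (\<lambda>x. invariants_deriv v x \<bullet> i)) (at v within S)"
    proof cases
      case 1
      show ?thesis
        unfolding 1 inner_axis invariants_def invariants_deriv_def vector_3
        by (rule derivative_eq_intros D refl)+ (simp add: algebra_simps fun_eq_iff)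
    next
      case 2
      show ?thesis
        unfolding 2 inner_axis invariants_def invariants_deriv_def vector_3
        by (rule derivative_eq_intros D refl)+ (simp add: algebra_simps fun_eq_iff)
    next
      case 3
      show ?thesis
        unfolding 3 inner_axis invariants_def invariants_deriv_def vector_3
        by (rule derivative_eq_intros D refl)+ (simp add: algebra_simps fun_eq_iff power2_eq_square)
    qed
  qed
qed

text \<open>As for every reflection group, the Jacobian of the basic invariants is up to a constant the product
  of the linear forms that vanish on the mirrors, here the Vandermonde product in the squares. Together
  with the next lemma it turns the Jacobian into the square root of the discriminant.\<close>

lemma det_invariants_deriv:
  "det (matrix (invariants_deriv v)) =
     - 4 * (((v$1)^2 - (v$2)^2) * ((v$2)^2 - (v$3)^2) * ((v$1)^2 - (v$3)^2))"
proof -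
  have *: "det (matrix (invariants_deriv v)) =
      2*a * (c*a) * (2*c*(a^2+b^2)) + 2*b * (a*b) * (2*a*(b^2+c^2)) + 2*c * (b*c) * (2*b*(c^2+a^2))
      - 2*a * (a*b) * (2*b*(c^2+a^2)) - 2*b * (b*c) * (2*c*(a^2+b^2)) - 2*c * (c*a) * (2*a*(b^2+c^2))"
    if "a = v$1" "b = v$2" "c = v$3" for a b c
    by (simp add: det_3 matrix_def invariants_deriv_def axis_def that)
  show ?thesis unfolding *[OF refl refl refl] by algebra
qed

lemma cubic_disc_invariants:
  "cubic_disc (invariants v $ 1) (invariants v $ 3) ((invariants v $ 2)^2) =
     (((v$1)^2 - (v$2)^2) * ((v$2)^2 - (v$3)^2) * ((v$1)^2 - (v$3)^2))^2"
  using cubic_disc_roots[of "(v$1)^2" "(v$2)^2" "(v$3)^2"] by (simp add: invariants_def power_mult_distrib)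

lemma weyl_chamber_squares:
  assumes "v \<in> weyl_chamber"
  shows "(v$1)^2 > (v$2)^2" "(v$2)^2 > (v$3)^2" "v$1 > 0" "v$2 > 0"
  using assms power_strict_mono[of "\<bar>v$3\<bar>" "v$2" 2] power_strict_mono[of "v$2" "v$1" 2]
  by (auto simp: weyl_chamber_def)

text \<open>On the chamber the three squares are strictly decreasing, so they are recovered as the ordered roots
  of the cubic; \<open>a\<close> and \<open>b\<close> are positive, and then \<open>abc\<close> determines \<open>c\<close>.\<close>

lemma inj_on_invariants: "inj_on invariants weyl_chamber"
proof (rule inj_onI)
  fix v w assume v: "v \<in> weyl_chamber" and w: "w \<in> weyl_chamber" and eq: "invariants v = invariants w"
  have eqs: "invariants v $ 1 = invariants w $ 1" "invariants v $ 2 = invariants w $ 2" "invariants v $ 3 = invariants w $ 3"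
    using eq by simp_all
  have p2: "(v$1)^2 * (v$2)^2 * (v$3)^2 = (w$1)^2 * (w$2)^2 * (w$3)^2"
    using arg_cong[OF eqs(2), of "\<lambda>p. p^2"] by (simp add: invariants_def power_mult_distrib)
  have "(v$1)^2 = (w$1)^2 \<and> (v$2)^2 = (w$2)^2 \<and> (v$3)^2 = (w$3)^2"
    using weyl_chamber_squares[OF v] weyl_chamber_squares[OF w] eqs p2
    by (intro ordered_roots_unique) (simp_all add: invariants_def)
  then have 12: "v$1 = w$1" "v$2 = w$2"
    using weyl_chamber_squares[OF v] weyl_chamber_squares[OF w] by (simp_all add: power2_eq_iff)
  moreover have "v$3 = w$3"
    using eqs(2) 12 weyl_chamber_squares[OF w] by (simp add: invariants_def)
  ultimately show "v = w" by (simp add: vec_eq_iff forall_3)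
qed

lemma invariants_image: "invariants ` weyl_chamber = real_rooted_set"
proof (intro equalityI subsetI)
  fix y assume "y \<in> invariants ` weyl_chamber"
  then obtain v where v: "v \<in> weyl_chamber" and y: "y = invariants v" by auto
  note sq = weyl_chamber_squares[OF v]
  have "invariants v $ 1 > 0"
    using sq by (simp add: invariants_def add_pos_nonneg)
  moreover have "invariants v $ 3 > 0"
    using sq by (simp add: invariants_def add_pos_nonneg)
  moreover have "cubic_disc (invariants v $ 1) (invariants v $ 3) ((invariants v $ 2)^2) > 0"
    unfolding cubic_disc_invariants by (intro zero_less_power mult_pos_pos) (use sq in simp_all)
  ultimately show "y \<in> real_rooted_set" by (simp add: real_rooted_set_def y)
next
  fix y assume "y \<in> real_rooted_set"
  then have "y$1 > 0" "y$3 > 0" "(y$2)^2 \<ge> 0" "cubic_disc (y$1) (y$3) ((y$2)^2) > 0"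
    by (auto simp: real_rooted_set_def)
  from real_roots_of_cubic[OF this] obtain a b c where abc: "a > b" "b > c" "c \<ge> 0" "a + b + c = y$1"
    "a*b + b*c + c*a = y$3" "a*b*c = (y$2)^2" by metis
  \<comment> \<open>The roots determine \<open>(a, b, c)\<close> up to signs; \<open>c\<close> inherits the sign of the product \<open>abc\<close>.\<close>
  define s :: real where "s = (if y$2 \<ge> 0 then 1 else -1)"
  have s: "s^2 = 1" "s * \<bar>y$2\<bar> = y$2" "\<bar>s\<bar> = 1" by (auto simp: s_def)
  define v :: "real^3" where "v = vector [sqrt a, sqrt b, s * sqrt c]"
  have "sqrt a * sqrt b * (s * sqrt c) = s * sqrt (a*b*c)" by (simp add: real_sqrt_mult)
  also have "\<dots> = y$2" using s by (simp add: abc)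
  finally have "invariants v $ 2 = y$2" by (simp add: invariants_def v_def)
  moreover have "invariants v $ 1 = y$1" "invariants v $ 3 = y$3"
    using abc s by (simp_all add: invariants_def v_def power_mult_distrib)
  ultimately have "y = invariants v" by (simp add: vec_eq_iff forall_3)
  moreover have "v \<in> weyl_chamber"
    using abc s by (simp add: weyl_chamber_def v_def abs_mult)
  ultimately show "y \<in> invariants ` weyl_chamber" by blast
qed

text \<open>On the chamber the Jacobian is four times the root of the discriminant. This produces the inverse
  square root of \<open>Q\<^sub>4\<close> in the density.\<close>

lemma nn_integral_invariants:
  fixes F :: "real \<Rightarrow> real \<Rightarrow> real \<Rightarrow> real"
  assumes F [measurable]: "(\<lambda>(t,p,q). F t p q) \<in> borel_measurable borel"
    and nonneg: "\<And>t p q. 0 \<le> F t p q"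
  shows "(\<integral>\<^sup>+a. \<integral>\<^sup>+b. \<integral>\<^sup>+c. (if a > b \<and> b > \<bar>c\<bar> then ennreal
            (F (a^2 + b^2 + c^2) (a*b*c) (a^2*b^2 + b^2*c^2 + c^2*a^2)) else 0) \<partial>lborel \<partial>lborel \<partial>lborel) =
         (\<integral>\<^sup>+t. \<integral>\<^sup>+p. \<integral>\<^sup>+q. (if t > 0 \<and> q > 0 \<and> cubic_disc t q (p^2) > 0 then ennreal
            (F t p q / (4 * sqrt (cubic_disc t q (p^2)))) else 0) \<partial>lborel \<partial>lborel \<partial>lborel)"
    (is "?lhs = ?rhs")
proof -
  \<comment> \<open>Outside the image the discriminant may be negative; \<open>max\<close> keeps \<open>G\<close> nonnegative everywhere.\<close>
  define G :: "real^3 \<Rightarrow> real" where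
    "G y = F (y$1) (y$2) (y$3) / (4 * sqrt (max 0 (cubic_disc (y$1) (y$3) ((y$2)^2))))" for y
  let ?J = "\<lambda>v. \<bar>det (matrix (invariants_deriv v))\<bar>"
  have F' [measurable]: "(\<lambda>x. F (f x) (g x) (h x)) \<in> borel_measurable M"
    if [measurable]: "f \<in> borel_measurable M" "g \<in> borel_measurable M" "h \<in> borel_measurable M"
    for f g h and M :: "'z measure"
    using measurable_compose[OF _ F, of "\<lambda>x. (f x, g x, h x)" M] that by (simp add: borel_prod[symmetric])
  have [measurable]: "invariants \<in> borel_measurable borel"
    unfolding invariants_def by measurable
  have Gm [measurable]: "G \<in> borel_measurable borel"
    unfolding G_def cubic_disc_def by measurable
  have [measurable]: "weyl_chamber \<in> sets borel" "real_rooted_set \<in> sets borel"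
    unfolding weyl_chamber_def real_rooted_set_def cubic_disc_def by measurable
  have Jm: "(\<lambda>v. ?J v * G (invariants v)) \<in> borel_measurable borel"
    unfolding det_invariants_deriv by measurable
  have Gnn: "0 \<le> G y" for y
    using nonneg by (simp add: G_def)
  have JG: "?J v * G (invariants v) = F (invariants v $ 1) (invariants v $ 2) (invariants v $ 3)"
    if "v \<in> weyl_chamber" for v
  proof -
    define V where "V = ((v$1)^2 - (v$2)^2) * ((v$2)^2 - (v$3)^2) * ((v$1)^2 - (v$3)^2)"
    have "V > 0"
      unfolding V_def by (intro mult_pos_pos) (use weyl_chamber_squares[OF that] in simp_all)
    then show ?thesis
      unfolding G_def cubic_disc_invariants det_invariants_deriv V_def[symmetric]
      by (simp add: max_absorb2 abs_mult)
  qed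
  have "?lhs = (\<integral>\<^sup>+v. indicator weyl_chamber v * ennreal (F (invariants v $ 1) (invariants v $ 2) (invariants v $ 3)) \<partial>lborel)"
    by (subst nn_integral_real3, measurable) (auto simp: invariants_def weyl_chamber_def indicator_def intro!: nn_integral_cong)
  also have "\<dots> = (\<integral>\<^sup>+v. indicator weyl_chamber v * ennreal (?J v * G (invariants v)) \<partial>lborel)"
    by (intro nn_integral_cong) (auto simp: indicator_def JG)
  also have "\<dots> = (\<integral>\<^sup>+y. indicator (invariants ` weyl_chamber) y * ennreal (G y) \<partial>lborel)"
    by (rule nn_integral_change_of_variables)
      (use Jm Gm Gnn in \<open>simp_all add: invariants_image inj_on_invariants has_derivative_invariants\<close>)
  also have "\<dots> = (\<integral>\<^sup>+y. indicator real_rooted_set y * ennreal (G y) \<partial>lborel)"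
    by (simp add: invariants_image)
  also have "\<dots> = ?rhs"
    by (subst nn_integral_real3, measurable) (auto simp: G_def real_rooted_set_def indicator_def max_absorb2 intro!: nn_integral_cong)
  finally show ?thesis .
qed

section \<open>Tetrahedral symmetry\<close>

text \<open>The sum condition says that the preimages of \<open>P\<close> under the first \<open>n\<close> powers of \<open>T\<close> tile the space up
  to a null set; they contribute equal amounts to the integral. In this form simplification decides the
  condition for a concrete \<open>n\<close>.\<close>

lemma nn_integral_cyclic_symmetry:
  fixes T :: "'a \<Rightarrow> 'a" and f :: "'a \<Rightarrow> ennreal"
  assumes T: "distr N N T = N" and [measurable]: "T \<in> measurable N N"
    and [measurable]: "f \<in> borel_measurable N" "Measurable.pred N P"
    and inv: "\<And>z. f (T z) = f z"
    and dom: "AE z in N. (\<Sum>i<n. of_bool (P ((T ^^ i) z))) = (1::nat)"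
  shows "(\<integral>\<^sup>+z. f z \<partial>N) = of_nat n * (\<integral>\<^sup>+z. (if P z then f z else 0) \<partial>N)"
proof -
  have Ti [measurable]: "(T ^^ i) \<in> measurable N N" for i
    by (induction i) simp_all
  have inv_i: "f ((T ^^ i) z) = f z" for i z
    by (induction i) (simp_all add: inv)
  have distr_i: "distr N N (T ^^ i) = N" for i
  proof (induction i)
    case (Suc i)
    have "distr N N (T ^^ Suc i) = distr (distr N N (T ^^ i)) N T"
      by (simp add: distr_distr)
    then show ?case unfolding Suc.IH T .
  qed (simp add: distr_id)
  let ?g = "\<lambda>z. if P z then f z else 0"
  have "(\<integral>\<^sup>+z. f z \<partial>N) = (\<integral>\<^sup>+z. (\<Sum>i<n. ?g ((T ^^ i) z)) \<partial>N)"
  proof (rule nn_integral_cong_AE, use dom in eventually_elim)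
    fix z assume one: "(\<Sum>i<n. of_bool (P ((T ^^ i) z))) = (1::nat)"
    have "(\<Sum>i<n. ?g ((T ^^ i) z)) = (\<Sum>i<n. of_nat (of_bool (P ((T ^^ i) z))) * f z)"
      by (intro sum.cong) (auto simp: inv_i)
    also have "\<dots> = of_nat (\<Sum>i<n. of_bool (P ((T ^^ i) z))) * f z"
      by (simp only: sum_distrib_right of_nat_sum)
    finally show "f z = (\<Sum>i<n. ?g ((T ^^ i) z))" by (simp only: one of_nat_1 mult_1)
  qed
  also have "\<dots> = (\<Sum>i<n. (\<integral>\<^sup>+z. ?g ((T ^^ i) z) \<partial>N))"
    by (subst nn_integral_sum) auto
  also have "\<dots> = (\<Sum>i<n. (\<integral>\<^sup>+z. ?g z \<partial>N))"
  proof (rule sum.cong)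
    fix i
    have "(\<integral>\<^sup>+z. ?g z \<partial>distr N N (T ^^ i)) = (\<integral>\<^sup>+z. ?g ((T ^^ i) z) \<partial>N)"
      by (subst nn_integral_distr) auto
    then show "(\<integral>\<^sup>+z. ?g ((T ^^ i) z) \<partial>N) = (\<integral>\<^sup>+z. ?g z \<partial>N)"
      by (simp add: distr_i)
  qed simp
  finally show ?thesis by simp
qed

text \<open>Lebesgue measure is determined by its values on boxes.\<close>

lemma distr_lborel_triple:
  fixes T :: "real \<times> real \<times> real \<Rightarrow> real \<times> real \<times> real"
  assumes T: "T \<in> borel_measurable borel"
    and box: "\<And>l1 l2 l3 u1 u2 u3. l1 \<le> u1 \<Longrightarrow> l2 \<le> u2 \<Longrightarrow> l3 \<le> u3 \<Longrightarrow>
      emeasure lborel (T -` box (l1,l2,l3) (u1,u2,u3)) = ennreal ((u1 - l1) * (u2 - l2) * (u3 - l3))"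
  shows "distr lborel lborel T = lborel"
proof -
  have "lborel = distr lborel lborel T"
  proof (rule lborel_eqI)
    fix l u :: "real \<times> real \<times> real" assume le: "\<And>b. b \<in> Basis \<Longrightarrow> l \<bullet> b \<le> u \<bullet> b"
    obtain l1 l2 l3 u1 u2 u3 where lu: "l = (l1,l2,l3)" "u = (u1,u2,u3)" by (metis prod_cases3)
    have "l1 \<le> u1" "l2 \<le> u2" "l3 \<le> u3"
      using le[of "(1,0,0)"] le[of "(0,1,0)"] le[of "(0,0,1)"] by (simp_all add: lu Basis_triple)
    from box[OF this] show "emeasure (distr lborel lborel T) (box l u) = ennreal (\<Prod>b\<in>Basis. (u - l) \<bullet> b)"
      unfolding prod_Basis_triple using T by (subst emeasure_distr) (auto simp: lu)
  qed simp
  then show ?thesis by simp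
qed

lemma measurable_triple_maps [measurable]:
  "(\<lambda>(a,b,c). (b,c,a)) \<in> borel_measurable (borel :: (real \<times> real \<times> real) measure)"
  "(\<lambda>(a,b,c). (a,c,b)) \<in> borel_measurable (borel :: (real \<times> real \<times> real) measure)"
  "(\<lambda>(a,b,c). (-a,-b,c)) \<in> borel_measurable (borel :: (real \<times> real \<times> real) measure)"
  "(\<lambda>(a,b,c). (a,-b,-c)) \<in> borel_measurable (borel :: (real \<times> real \<times> real) measure)"
  by (simp_all add: borel_prod[symmetric])

lemma distr_lborel_rotate: "distr lborel lborel (\<lambda>(a,b,c). (b,c,a)) = (lborel :: (real \<times> real \<times> real) measure)"
proof (rule distr_lborel_triple)
  fix l1 l2 l3 u1 u2 u3 :: real assume "l1 \<le> u1" "l2 \<le> u2" "l3 \<le> u3"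
  moreover have "(\<lambda>(a,b,c). (b,c,a)) -` box (l1,l2,l3) (u1,u2,u3) = box (l3,l1,l2) (u3,u1,u2)"
    by (auto simp: mem_box_triple)
  ultimately show "emeasure lborel ((\<lambda>(a,b,c). (b,c,a)) -` box (l1,l2,l3) (u1,u2,u3)) =
      ennreal ((u1 - l1) * (u2 - l2) * (u3 - l3))"
    by (simp add: emeasure_lborel_box_triple mult_ac)
qed measurable

lemma distr_lborel_swap: "distr lborel lborel (\<lambda>(a,b,c). (a,c,b)) = (lborel :: (real \<times> real \<times> real) measure)"
proof (rule distr_lborel_triple)
  fix l1 l2 l3 u1 u2 u3 :: real assume "l1 \<le> u1" "l2 \<le> u2" "l3 \<le> u3"
  moreover have "(\<lambda>(a,b,c). (a,c,b)) -` box (l1,l2,l3) (u1,u2,u3) = box (l1,l3,l2) (u1,u3,u2)"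
    by (auto simp: mem_box_triple)
  ultimately show "emeasure lborel ((\<lambda>(a,b,c). (a,c,b)) -` box (l1,l2,l3) (u1,u2,u3)) =
      ennreal ((u1 - l1) * (u2 - l2) * (u3 - l3))"
    by (simp add: emeasure_lborel_box_triple mult_ac)
qed measurable

lemma distr_lborel_neg12: "distr lborel lborel (\<lambda>(a,b,c). (-a,-b,c)) = (lborel :: (real \<times> real \<times> real) measure)"
proof (rule distr_lborel_triple)
  fix l1 l2 l3 u1 u2 u3 :: real assume "l1 \<le> u1" "l2 \<le> u2" "l3 \<le> u3"
  moreover have "(\<lambda>(a,b,c). (-a,-b,c)) -` box (l1,l2,l3) (u1,u2,u3) = box (-u1,-u2,l3) (-l1,-l2,u3)"
    by (auto simp: mem_box_triple)
  ultimately show "emeasure lborel ((\<lambda>(a,b,c). (-a,-b,c)) -` box (l1,l2,l3) (u1,u2,u3)) =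
      ennreal ((u1 - l1) * (u2 - l2) * (u3 - l3))"
    by (simp add: emeasure_lborel_box_triple mult_ac)
qed measurable

lemma distr_lborel_neg23: "distr lborel lborel (\<lambda>(a,b,c). (a,-b,-c)) = (lborel :: (real \<times> real \<times> real) measure)"
proof (rule distr_lborel_triple)
  fix l1 l2 l3 u1 u2 u3 :: real assume "l1 \<le> u1" "l2 \<le> u2" "l3 \<le> u3"
  moreover have "(\<lambda>(a,b,c). (a,-b,-c)) -` box (l1,l2,l3) (u1,u2,u3) = box (l1,-u2,-u3) (u1,-l2,-l3)"
    by (auto simp: mem_box_triple)
  ultimately show "emeasure lborel ((\<lambda>(a,b,c). (a,-b,-c)) -` box (l1,l2,l3) (u1,u2,u3)) =
      ennreal ((u1 - l1) * (u2 - l2) * (u3 - l3))"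
    by (simp add: emeasure_lborel_box_triple mult_ac)
qed measurable

text \<open>The planes where two absolute values agree separate the chambers; \<open>a = 0\<close> and \<open>b = 0\<close> separate the
  intermediate domains from which the chamber is cut out. All of them are null.\<close>

lemma AE_distinct_abs_triple:
  "AE z in (lborel :: (real \<times> real \<times> real) measure). case z of (a, b, c) \<Rightarrow>
     \<bar>a\<bar> \<noteq> \<bar>b\<bar> \<and> \<bar>b\<bar> \<noteq> \<bar>c\<bar> \<and> \<bar>a\<bar> \<noteq> \<bar>c\<bar> \<and> a \<noteq> 0 \<and> b \<noteq> 0"
proof -
  let ?P = "\<lambda>a b c :: real. \<bar>a\<bar> \<noteq> \<bar>b\<bar> \<and> \<bar>b\<bar> \<noteq> \<bar>c\<bar> \<and> \<bar>a\<bar> \<noteq> \<bar>c\<bar> \<and> a \<noteq> 0 \<and> b \<noteq> 0"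
  have ae: "AE y in lborel. \<bar>x\<bar> \<noteq> \<bar>y\<bar>" for x :: real
    using AE_lborel_singleton[of x] AE_lborel_singleton[of "-x"] by eventually_elim (auto simp: abs_if)
  have w: "AE w in (lborel \<Otimes>\<^sub>M lborel). ?P a (fst w) (snd w)" if "a \<noteq> 0" for a :: real
  proof (rule lborel_pair.AE_pair_measure)
    show "AE b in lborel. AE c in lborel. ?P a (fst (b, c)) (snd (b, c))"
      using ae[of a] ae[of 0]
    proof eventually_elim
      case (elim b)
      show ?case using ae[of a] ae[of b] by eventually_elim (use elim that in auto)
    qed
  qed measurable
  have "AE a in lborel. AE w in lborel.
      ?P (fst (a, w)) (fst (snd (a, w))) (snd (snd (a, w)))"
    using AE_lborel_singleton[of "0::real"]
  proof eventually_elim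
    case (elim a)
    show ?case using w[OF elim] unfolding lborel_prod fst_conv snd_conv .
  qed
  then have "AE z in (lborel :: real measure) \<Otimes>\<^sub>M (lborel :: (real \<times> real) measure).
      ?P (fst z) (fst (snd z)) (snd (snd z))"
    by (intro lborel_pair.AE_pair_measure) (auto simp: lborel_prod borel_prod[symmetric])
  then show ?thesis unfolding lborel_prod case_prod_beta .
qed

text \<open>The symmetries of \<open>(a, b, c)\<close> that come from the 24 permutations of the sample: all permutations of
  the coordinates and all even sign changes, which is the symmetry group of a regular tetrahedron.\<close>

lemma nn_integral_tetrahedral_symmetry:
  fixes f :: "real \<Rightarrow> real \<Rightarrow> real \<Rightarrow> ennreal"
  assumes meas: "(\<lambda>(a,b,c). f a b c) \<in> borel_measurable borel"
    and rot: "\<And>a b c. f b c a = f a b c" and swap: "\<And>a b c. f a c b = f a b c"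
    and neg: "\<And>a b c. f (-a) (-b) c = f a b c"
  shows "(\<integral>\<^sup>+a. \<integral>\<^sup>+b. \<integral>\<^sup>+c. f a b c \<partial>lborel \<partial>lborel \<partial>lborel) =
     24 * (\<integral>\<^sup>+a. \<integral>\<^sup>+b. \<integral>\<^sup>+c. (if a > b \<and> b > \<bar>c\<bar> then f a b c else 0) \<partial>lborel \<partial>lborel \<partial>lborel)"
proof -
  have neg': "f a (-b) (-c) = f a b c" for a b c
    using neg[of b c a] rot by metis
  define F where "F z = f (fst z) (fst (snd z)) (snd (snd z))" for z
  \<comment> \<open>The chamber is reached in four steps, which divide the domain by 3, 2, 2 and 2: make \<open>\<bar>a\<bar>\<close> the
    largest by a cyclic shift, order \<open>\<bar>b\<bar>\<close> and \<open>\<bar>c\<bar>\<close> by a swap, then make \<open>a\<close> and \<open>b\<close>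
    positive by flipping two signs at a time.\<close>
  define P1 where "P1 z \<longleftrightarrow> \<bar>fst z\<bar> > \<bar>fst (snd z)\<bar> \<and> \<bar>fst z\<bar> > \<bar>snd (snd z)\<bar>" for z :: "real \<times> real \<times> real"
  define P2 where "P2 z \<longleftrightarrow> \<bar>fst (snd z)\<bar> > \<bar>snd (snd z)\<bar>" for z :: "real \<times> real \<times> real"
  define P3 where "P3 z \<longleftrightarrow> fst z > 0" for z :: "real \<times> real \<times> real"
  define P4 where "P4 z \<longleftrightarrow> fst (snd z) > 0" for z :: "real \<times> real \<times> real"
  have F [measurable]: "F \<in> borel_measurable borel"
    using meas unfolding F_def by (simp add: case_prod_beta')
  have [measurable]: "Measurable.pred borel P1" "Measurable.pred borel P2"
    "Measurable.pred borel P3" "Measurable.pred borel P4"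
    unfolding P1_def P2_def P3_def P4_def by (simp_all add: borel_prod[symmetric])
  define F1 where "F1 z = (if P1 z then F z else 0)" for z
  define F2 where "F2 z = (if P2 z then F1 z else 0)" for z
  define F3 where "F3 z = (if P3 z then F2 z else 0)" for z
  define F4 where "F4 z = (if P4 z then F3 z else 0)" for z
  have [measurable]: "F1 \<in> borel_measurable borel" "F2 \<in> borel_measurable borel" "F3 \<in> borel_measurable borel"
    unfolding F1_def F2_def F3_def by measurable
  have inv1: "F (case z of (a,b,c) \<Rightarrow> (b,c,a)) = F z" for z
    by (cases z) (simp add: F_def rot)
  have inv2: "F1 (case z of (a,b,c) \<Rightarrow> (a,c,b)) = F1 z" for z
    by (cases z) (auto simp: F1_def P1_def F_def swap)
  have inv3: "F2 (case z of (a,b,c) \<Rightarrow> (-a,-b,c)) = F2 z" for z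
    by (cases z) (simp add: F2_def F1_def P2_def P1_def F_def neg)
  have inv4: "F3 (case z of (a,b,c) \<Rightarrow> (a,-b,-c)) = F3 z" for z
    by (cases z) (simp add: F3_def F2_def F1_def P3_def P2_def P1_def F_def neg')
  have "integral\<^sup>N lborel F = of_nat 3 * integral\<^sup>N lborel F1"
    unfolding F1_def
  proof (rule nn_integral_cyclic_symmetry[OF distr_lborel_rotate])
    show "AE z in lborel. (\<Sum>i<3. of_bool (P1 ((((\<lambda>(a,b,c). (b,c,a)) ^^ i) z)))) = (1::nat)"
      using AE_distinct_abs_triple
    proof eventually_elim
      case (elim z)
      then show ?case
        by (cases z) (auto simp: P1_def numeral_3_eq_3 lessThan_Suc simp del: sum_of_bool_eq)
    qed
  qed (auto simp: inv1)
  also have "integral\<^sup>N lborel F1 = of_nat 2 * integral\<^sup>N lborel F2"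
    unfolding F2_def
  proof (rule nn_integral_cyclic_symmetry[OF distr_lborel_swap])
    show "AE z in lborel. (\<Sum>i<2. of_bool (P2 ((((\<lambda>(a,b,c). (a,c,b)) ^^ i) z)))) = (1::nat)"
      using AE_distinct_abs_triple
      by eventually_elim (auto simp: P2_def numeral_2_eq_2 lessThan_Suc simp del: sum_of_bool_eq)
  qed (auto simp: inv2)
  also have "integral\<^sup>N lborel F2 = of_nat 2 * integral\<^sup>N lborel F3"
    unfolding F3_def
  proof (rule nn_integral_cyclic_symmetry[OF distr_lborel_neg12])
    show "AE z in lborel. (\<Sum>i<2. of_bool (P3 ((((\<lambda>(a,b,c). (-a,-b,c)) ^^ i) z)))) = (1::nat)"
      using AE_distinct_abs_triple by eventually_elim (auto simp: P3_def numeral_2_eq_2 lessThan_Suc simp del: sum_of_bool_eq)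
  qed (auto simp: inv3)
  also have "integral\<^sup>N lborel F3 = of_nat 2 * integral\<^sup>N lborel F4"
    unfolding F4_def
  proof (rule nn_integral_cyclic_symmetry[OF distr_lborel_neg23])
    show "AE z in lborel. (\<Sum>i<2. of_bool (P4 ((((\<lambda>(a,b,c). (a,-b,-c)) ^^ i) z)))) = (1::nat)"
      using AE_distinct_abs_triple by eventually_elim (auto simp: P4_def numeral_2_eq_2 lessThan_Suc simp del: sum_of_bool_eq)
  qed (auto simp: inv4)
  finally have "integral\<^sup>N lborel F = 24 * integral\<^sup>N lborel F4"
    by (simp add: mult.assoc[symmetric])
  moreover have "integral\<^sup>N lborel F4 =
      (\<integral>\<^sup>+z. (if fst z > fst (snd z) \<and> fst (snd z) > \<bar>snd (snd z)\<bar> then F z else 0) \<partial>lborel)"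
    by (intro nn_integral_cong) (auto simp: F4_def F3_def F2_def F1_def P4_def P3_def P2_def P1_def)
  moreover have "(\<lambda>(a,b,c). if a > b \<and> b > \<bar>c\<bar> then f a b c else 0) \<in> borel_measurable borel"
    using F unfolding F_def case_prod_beta' borel_prod[symmetric] by measurable
  ultimately show ?thesis
    unfolding F_def using nn_integral_triple[OF meas] 
      nn_integral_triple[of "\<lambda>a b c. if a > b \<and> b > \<bar>c\<bar> then f a b c else 0"]
    by simp
qed

section \<open>The Hadamard transform of a normal sample\<close>

text \<open>A planar rotation by half a right angle, up to scaling and reflection. Two rounds of it make up
  the Hadamard transform, in the manner of the fast Walsh-Hadamard algorithm.\<close>

lemma nn_integral_butterfly:
  fixes f :: "real \<Rightarrow> real \<Rightarrow> ennreal"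
  assumes f: "(\<lambda>(x,y). f x y) \<in> borel_measurable (borel \<Otimes>\<^sub>M borel)" and c: "c \<noteq> 0"
  shows "(\<integral>\<^sup>+x. \<integral>\<^sup>+y. f x y \<partial>lborel \<partial>lborel) =
    ennreal (2 * c^2) * (\<integral>\<^sup>+u. \<integral>\<^sup>+v. f (c * (u + v)) (c * (u - v)) \<partial>lborel \<partial>lborel)"
proof -
  have f' [measurable]: "(\<lambda>z. f (g z) (h z)) \<in> borel_measurable M"
    if [measurable]: "g \<in> borel_measurable M" "h \<in> borel_measurable M" for g h and M :: "'z measure"
    using measurable_compose[OF _ f, of "\<lambda>z. (g z, h z)" M] that by simp
  \<comment> \<open>For fixed \<open>x\<close> substitute \<open>y = x - 2cv\<close>, then for fixed \<open>v\<close> substitute \<open>x = c(u + v)\<close>.\<close>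
  have "(\<integral>\<^sup>+x. \<integral>\<^sup>+y. f x y \<partial>lborel \<partial>lborel) = (\<integral>\<^sup>+x. \<bar>-2 * c\<bar> * (\<integral>\<^sup>+v. f x (x + (-2 * c) * v) \<partial>lborel) \<partial>lborel)"
    using c by (intro nn_integral_cong nn_integral_real_affine) auto
  also have "\<dots> = \<bar>-2 * c\<bar> * (\<integral>\<^sup>+x. (\<integral>\<^sup>+v. f x (x + (-2 * c) * v) \<partial>lborel) \<partial>lborel)"
    by (rule nn_integral_cmult) measurable
  also have "(\<integral>\<^sup>+x. (\<integral>\<^sup>+v. f x (x + (-2 * c) * v) \<partial>lborel) \<partial>lborel) =
      (\<integral>\<^sup>+v. (\<integral>\<^sup>+x. f x (x + (-2 * c) * v) \<partial>lborel) \<partial>lborel)"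
    by (rule lborel_pair.Fubini'[symmetric]) measurable
  also have "\<dots> = (\<integral>\<^sup>+v. \<bar>c\<bar> * (\<integral>\<^sup>+u. f (c * v + c * u) ((c * v + c * u) + (-2 * c) * v) \<partial>lborel) \<partial>lborel)"
    using c by (intro nn_integral_cong nn_integral_real_affine) auto
  also have "\<dots> = (\<integral>\<^sup>+v. \<bar>c\<bar> * (\<integral>\<^sup>+u. f (c * (u + v)) (c * (u - v)) \<partial>lborel) \<partial>lborel)"
    by (simp add: algebra_simps)
  also have "\<dots> = \<bar>c\<bar> * (\<integral>\<^sup>+v. (\<integral>\<^sup>+u. f (c * (u + v)) (c * (u - v)) \<partial>lborel) \<partial>lborel)"
    by (rule nn_integral_cmult) measurable
  also have "(\<integral>\<^sup>+v. (\<integral>\<^sup>+u. f (c * (u + v)) (c * (u - v)) \<partial>lborel) \<partial>lborel) =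
     (\<integral>\<^sup>+u. (\<integral>\<^sup>+v. f (c * (u + v)) (c * (u - v)) \<partial>lborel) \<partial>lborel)"
    by (rule lborel_pair.Fubini') measurable
  also have "ennreal \<bar>-2 * c\<bar> * (ennreal \<bar>c\<bar> * x) = ennreal (2 * c^2) * x" for x
  proof -
    have "\<bar>-2 * c\<bar> * \<bar>c\<bar> = 2 * c^2" by (simp add: abs_mult power2_eq_square)
    then show ?thesis by (metis abs_ge_zero ennreal_mult mult.assoc)
  qed
  finally show ?thesis .
qed

text \<open>The transform has determinant \<open>\<plusminus>1\<close>. It factors into the planar maps of the preceding lemma applied to
  \<open>(x\<^sub>1, x\<^sub>2)\<close> and \<open>(x\<^sub>3, x\<^sub>4)\<close> with factor 1 and then to the sums and the differences with factor
  \<open>1/2\<close>.\<close>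

lemma nn_integral_Hadamard:
  fixes H :: "real \<Rightarrow> real \<Rightarrow> real \<Rightarrow> real \<Rightarrow> ennreal"
  assumes H: "(\<lambda>(x1,x2,x3,x4). H x1 x2 x3 x4) \<in> borel_measurable borel"
  shows "(\<integral>\<^sup>+x1. \<integral>\<^sup>+x2. \<integral>\<^sup>+x3. \<integral>\<^sup>+x4. H x1 x2 x3 x4 \<partial>lborel \<partial>lborel \<partial>lborel \<partial>lborel) =
    (\<integral>\<^sup>+m. \<integral>\<^sup>+a. \<integral>\<^sup>+b. \<integral>\<^sup>+c. H ((m+a+b+c)/2) ((m+a-b-c)/2) ((m-a+b-c)/2) ((m-a-b+c)/2)
       \<partial>lborel \<partial>lborel \<partial>lborel \<partial>lborel)"
proof -
  have H' [measurable]: "(\<lambda>z. H (f z) (g z) (h z) (k z)) \<in> borel_measurable M"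
    if [measurable]: "f \<in> borel_measurable M" "g \<in> borel_measurable M" "h \<in> borel_measurable M"
      "k \<in> borel_measurable M" for f g h k and M :: "'z measure"
    using measurable_compose[OF _ H, of "\<lambda>z. (f z, g z, h z, k z)" M] that by (simp add: borel_prod[symmetric])
  have "(\<integral>\<^sup>+x1. \<integral>\<^sup>+x2. \<integral>\<^sup>+x3. \<integral>\<^sup>+x4. H x1 x2 x3 x4 \<partial>lborel \<partial>lborel \<partial>lborel \<partial>lborel) =
    2 * (\<integral>\<^sup>+u. \<integral>\<^sup>+v. \<integral>\<^sup>+x3. \<integral>\<^sup>+x4. H (u + v) (u - v) x3 x4 \<partial>lborel \<partial>lborel \<partial>lborel \<partial>lborel)"
    by (subst nn_integral_butterfly[where c=1]) (simp_all, measurable)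
  also have "\<dots> = 4 * (\<integral>\<^sup>+u. \<integral>\<^sup>+v. \<integral>\<^sup>+w. \<integral>\<^sup>+z. H (u + v) (u - v) (w + z) (w - z) \<partial>lborel \<partial>lborel \<partial>lborel \<partial>lborel)"
  proof -
    have "(\<integral>\<^sup>+x3. \<integral>\<^sup>+x4. H (u + v) (u - v) x3 x4 \<partial>lborel \<partial>lborel) =
        2 * (\<integral>\<^sup>+w. \<integral>\<^sup>+z. H (u + v) (u - v) (w + z) (w - z) \<partial>lborel \<partial>lborel)" for u v
      by (subst nn_integral_butterfly[where c=1]) (simp_all, measurable)
    then show ?thesis by (simp add: nn_integral_cmult mult.assoc[symmetric])
  qed
  also have "(\<integral>\<^sup>+u. \<integral>\<^sup>+v. \<integral>\<^sup>+w. \<integral>\<^sup>+z. H (u + v) (u - v) (w + z) (w - z) \<partial>lborel \<partial>lborel \<partial>lborel \<partial>lborel) =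
     (\<integral>\<^sup>+u. \<integral>\<^sup>+w. \<integral>\<^sup>+v. \<integral>\<^sup>+z. H (u + v) (u - v) (w + z) (w - z) \<partial>lborel \<partial>lborel \<partial>lborel \<partial>lborel)"
    by (intro nn_integral_cong lborel_pair.Fubini') measurable
  also have "\<dots> = (\<integral>\<^sup>+u. \<integral>\<^sup>+w. ennreal (1/2) * (\<integral>\<^sup>+b. \<integral>\<^sup>+c.
      H (u + (b + c)/2) (u - (b + c)/2) (w + (b - c)/2) (w - (b - c)/2) \<partial>lborel \<partial>lborel) \<partial>lborel \<partial>lborel)"
  proof (intro nn_integral_cong)
    fix u w
    have "(\<integral>\<^sup>+v. \<integral>\<^sup>+z. H (u + v) (u - v) (w + z) (w - z) \<partial>lborel \<partial>lborel) =
      ennreal (2 * (1/2)^2) * (\<integral>\<^sup>+b. \<integral>\<^sup>+c.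
      H (u + 1/2 * (b + c)) (u - 1/2 * (b + c)) (w + 1/2 * (b - c)) (w - 1/2 * (b - c)) \<partial>lborel \<partial>lborel)"
      by (rule nn_integral_butterfly) (simp_all, measurable)
    then show "(\<integral>\<^sup>+v. \<integral>\<^sup>+z. H (u + v) (u - v) (w + z) (w - z) \<partial>lborel \<partial>lborel) =
      ennreal (1/2) * (\<integral>\<^sup>+b. \<integral>\<^sup>+c.
      H (u + (b + c)/2) (u - (b + c)/2) (w + (b - c)/2) (w - (b - c)/2) \<partial>lborel \<partial>lborel)"
      by (simp add: power2_eq_square)
  qed
  also have "\<dots> = ennreal (1/2) * (\<integral>\<^sup>+u. \<integral>\<^sup>+w. \<integral>\<^sup>+b. \<integral>\<^sup>+c.
      H (u + (b + c)/2) (u - (b + c)/2) (w + (b - c)/2) (w - (b - c)/2) \<partial>lborel \<partial>lborel \<partial>lborel \<partial>lborel)"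
    by (simp add: nn_integral_cmult)
  also have "(\<integral>\<^sup>+u. \<integral>\<^sup>+w. \<integral>\<^sup>+b. \<integral>\<^sup>+c.
      H (u + (b + c)/2) (u - (b + c)/2) (w + (b - c)/2) (w - (b - c)/2) \<partial>lborel \<partial>lborel \<partial>lborel \<partial>lborel) =
      ennreal (2 * (1/2)^2) * (\<integral>\<^sup>+m. \<integral>\<^sup>+a. \<integral>\<^sup>+b. \<integral>\<^sup>+c. H (1/2 * (m + a) + (b + c)/2) (1/2 * (m + a) - (b + c)/2)
        (1/2 * (m - a) + (b - c)/2) (1/2 * (m - a) - (b - c)/2) \<partial>lborel \<partial>lborel \<partial>lborel \<partial>lborel)"
    by (rule nn_integral_butterfly) (simp_all, measurable)
  also have "\<dots> = ennreal (1/2) * (\<integral>\<^sup>+m. \<integral>\<^sup>+a. \<integral>\<^sup>+b. \<integral>\<^sup>+c.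
      H ((m+a+b+c)/2) ((m+a-b-c)/2) ((m-a+b-c)/2) ((m-a-b+c)/2) \<partial>lborel \<partial>lborel \<partial>lborel \<partial>lborel)" (is "_ = _ * ?I")
    by (simp add: power2_eq_square add_divide_distrib diff_divide_distrib algebra_simps)
  also have "4 * (ennreal (1/2) * (ennreal (1/2) * ?I)) = ?I"
  proof -
    have "4 * ennreal h * ennreal h = ennreal (4 * h * h)" if "h \<ge> 0" for h
      using that by (simp add: ennreal_mult)
    from this[of "1/2"] have four: "4 * ennreal (1/2) * ennreal (1/2) = 1" by simp
    show ?thesis unfolding mult.assoc[symmetric] four by (rule mult_1)
  qed
  finally show ?thesis .
qed

text \<open>Independence makes the joint law a product measure, and Fubini's theorem unrolls it.\<close>

lemma nn_integral_iid4:
  fixes X :: "nat \<Rightarrow> 'a \<Rightarrow> real" and H :: "real \<Rightarrow> real \<Rightarrow> real \<Rightarrow> real \<Rightarrow> ennreal" and \<phi> :: "real \<Rightarrow> real"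
  assumes "prob_space M" and indep: "prob_space.indep_vars M (\<lambda>_. borel) X {1..4}"
    and X: "\<And>i. i \<in> {1..4} \<Longrightarrow> distributed M lborel (X i) (\<lambda>x. ennreal (\<phi> x))"
    and H: "(\<lambda>(x1,x2,x3,x4). H x1 x2 x3 x4) \<in> borel_measurable borel"
  shows "(\<integral>\<^sup>+\<omega>. H (X 1 \<omega>) (X 2 \<omega>) (X 3 \<omega>) (X 4 \<omega>) \<partial>M) =
    (\<integral>\<^sup>+x1. \<integral>\<^sup>+x2. \<integral>\<^sup>+x3. \<integral>\<^sup>+x4. ennreal (\<phi> x1) * ennreal (\<phi> x2) * ennreal (\<phi> x3) * ennreal (\<phi> x4)
       * H x1 x2 x3 x4 \<partial>lborel \<partial>lborel \<partial>lborel \<partial>lborel)"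
proof -
  interpret prob_space M by fact
  have H' [measurable]: "(\<lambda>z. H (f z) (g z) (h z) (k z)) \<in> borel_measurable M"
    if [measurable]: "f \<in> borel_measurable M" "g \<in> borel_measurable M" "h \<in> borel_measurable M"
      "k \<in> borel_measurable M" for f g h k and M :: "'z measure"
    using measurable_compose[OF _ H, of "\<lambda>z. (f z, g z, h z, k z)" M] that by (simp add: borel_prod[symmetric])
  have \<phi> [measurable]: "(\<lambda>x. ennreal (\<phi> x)) \<in> borel_measurable borel"
    using X[of 1] by (auto simp: distributed_def)
  define N where "N = density lborel (\<lambda>x. ennreal (\<phi> x))"
  have setsN [measurable_cong, simp]: "sets N = sets borel" by (simp add: N_def)
  have Xm [measurable]: "X i \<in> borel_measurable M" if "i \<in> {1..4}" for i
    using X[OF that] by (auto simp: distributed_def)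
  have distrX: "distr M borel (X i) = N" if "i \<in> {1..4}" for i
  proof -
    have "distr M borel (X i) = distr M lborel (X i)" by (rule distr_cong) auto
    then show ?thesis using X[OF that] by (simp add: distributed_def N_def)
  qed
  interpret N: prob_space N
    using prob_space_distr[OF Xm[of 1]] distrX[of 1] by simp
  interpret PN: product_sigma_finite "\<lambda>_::nat. N" ..
  have "distr M (\<Pi>\<^sub>M i\<in>{1..4}. borel) (\<lambda>\<omega>. \<lambda>i\<in>{1..4}. X i \<omega>) = (\<Pi>\<^sub>M i\<in>{1..4}. distr M borel (X i))"
    using indep by (subst (asm) indep_vars_iff_distr_eq_PiM') auto
  also have "\<dots> = (\<Pi>\<^sub>M i\<in>{1..4}. N)"
    by (intro PiM_cong) (simp_all add: distrX)
  finally have joint: "distr M (\<Pi>\<^sub>M i\<in>{1..4}. borel) (\<lambda>\<omega>. \<lambda>i\<in>{1..4}. X i \<omega>) = (\<Pi>\<^sub>M i\<in>{1..4::nat}. N)" .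
  let ?G = "\<lambda>x :: nat \<Rightarrow> real. H (x 1) (x 2) (x 3) (x 4)"
  have I4: "{1..4::nat} = insert 1 (insert 2 (insert 3 (insert 4 {})))" by auto
  have "(\<integral>\<^sup>+\<omega>. H (X 1 \<omega>) (X 2 \<omega>) (X 3 \<omega>) (X 4 \<omega>) \<partial>M) =
      (\<integral>\<^sup>+x. ?G x \<partial>distr M (\<Pi>\<^sub>M i\<in>{1..4}. borel) (\<lambda>\<omega>. \<lambda>i\<in>{1..4}. X i \<omega>))"
    by (subst nn_integral_distr) auto
  also have "\<dots> = (\<integral>\<^sup>+x. ?G x \<partial>(\<Pi>\<^sub>M i\<in>{1..4::nat}. N))"
    unfolding joint ..
  also have "\<dots> = (\<integral>\<^sup>+x1. \<integral>\<^sup>+x2. \<integral>\<^sup>+x3. \<integral>\<^sup>+x4. H x1 x2 x3 x4 \<partial>N \<partial>N \<partial>N \<partial>N)"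
    unfolding I4
    by (simp add: PN.product_nn_integral_insert_rev PiM_empty)
  also have "\<dots> = (\<integral>\<^sup>+x1. \<phi> x1 * (\<integral>\<^sup>+x2. \<phi> x2 * (\<integral>\<^sup>+x3. \<phi> x3 * (\<integral>\<^sup>+x4. \<phi> x4 * H x1 x2 x3 x4
      \<partial>lborel) \<partial>lborel) \<partial>lborel) \<partial>lborel)"
    unfolding N_def by (simp add: nn_integral_density)
  also have "\<dots> = (\<integral>\<^sup>+x1. \<integral>\<^sup>+x2. \<integral>\<^sup>+x3. \<integral>\<^sup>+x4. ennreal (\<phi> x1) * ennreal (\<phi> x2) * ennreal (\<phi> x3) * ennreal (\<phi> x4)
       * H x1 x2 x3 x4 \<partial>lborel \<partial>lborel \<partial>lborel \<partial>lborel)"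
    by (simp add: nn_integral_cmult[symmetric] mult.assoc)
  finally show ?thesis .
qed

text \<open>Orthogonality of the transform: the joint density depends on the squared distance to the constant
  vector \<open>\<mu>\<close>, which is \<open>(m - 2\<mu>)\<^sup>2 + a\<^sup>2 + b\<^sup>2 + c\<^sup>2\<close>. Hence \<open>m\<close> is independent of the isotropic vector
  \<open>(a, b, c)\<close>.\<close>

lemma normal_density_Hadamard:
  assumes "\<sigma> > 0"
  shows "normal_density \<mu> \<sigma> ((m+a+b+c)/2) * normal_density \<mu> \<sigma> ((m+a-b-c)/2) *
      normal_density \<mu> \<sigma> ((m-a+b-c)/2) * normal_density \<mu> \<sigma> ((m-a-b+c)/2) =
    normal_density (2 * \<mu>) \<sigma> m * (exp (- (a^2 + b^2 + c^2) / (2 * \<sigma>^2)) / sqrt (2 * pi * \<sigma>^2) ^ 3)"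
proof -
  define d where "d = 2 * \<sigma>^2"
  have "d > 0" using assms by (simp add: d_def)
  let ?s = "sqrt (2 * pi * \<sigma>^2)"
  have "exp (- (((m+a+b+c)/2 - \<mu>)^2 / d)) * exp (- (((m+a-b-c)/2 - \<mu>)^2 / d)) *
      exp (- (((m-a+b-c)/2 - \<mu>)^2 / d)) * exp (- (((m-a-b+c)/2 - \<mu>)^2 / d))
      = exp (- ((m - 2 * \<mu>)^2 / d)) * exp (- ((a^2 + b^2 + c^2) / d))"
    unfolding exp_add[symmetric]
    by (rule arg_cong[where f=exp]) (use \<open>d > 0\<close> in \<open>simp add: power2_eq_square field_simps\<close>)
  then show ?thesis
    unfolding normal_density_def d_def[symmetric] minus_divide_left
    by (simp add: power3_eq_cube)
qed

section \<open>From invariants to skewness and kurtosis\<close>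

text \<open>The value of \<open>\<Gamma>(3/2)\<close>, rescaled; it normalises the distribution of \<open>t = a\<^sup>2 + b\<^sup>2 + c\<^sup>2\<close>.\<close>

lemma nn_integral_radial:
  fixes \<beta> :: real
  assumes "\<beta> > 0"
  shows "(\<integral>\<^sup>+t. (if t > 0 then ennreal (sqrt t * exp (- t / \<beta>)) else 0) \<partial>lborel) =
    ennreal (\<beta> * sqrt \<beta> * sqrt pi / 2)" (is "?I = _")
proof -
  let ?f = "\<lambda>t::real. ennreal (indicator {0..} t * t powr (3/2 - 1) / exp t)"
  have Gam: "Gamma (3/2 :: real) = sqrt pi / 2"
  proof -
    have "(1/2 :: real) \<notin> \<int>\<^sub>\<le>\<^sub>0" by (auto elim!: nonpos_Ints_cases)
    from Gamma_plus1[OF this] show ?thesis by (simp add: Gamma_one_half_real)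
  qed
  have "ennreal (Gamma (3/2)) = (\<integral>\<^sup>+t. ?f t \<partial>lborel)"
    by (rule Gamma_conv_nn_integral_real) simp
  also have "\<dots> = \<bar>1/\<beta>\<bar> * (\<integral>\<^sup>+t. ?f (0 + 1/\<beta> * t) \<partial>lborel)"
    by (rule nn_integral_real_affine) (use assms in auto)
  also have "(\<integral>\<^sup>+t. ?f (0 + 1/\<beta> * t) \<partial>lborel) =
      (\<integral>\<^sup>+t. ennreal (1 / sqrt \<beta>) * (if t > 0 then ennreal (sqrt t * exp (- t / \<beta>)) else 0) \<partial>lborel)"
  proof (rule nn_integral_cong)
    fix t :: real
    consider "t < 0" | "t = 0" | "t > 0" by linarith
    then show "?f (0 + 1/\<beta> * t) = ennreal (1 / sqrt \<beta>) * (if t > 0 then ennreal (sqrt t * exp (- t / \<beta>)) else 0)"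
    proof cases
      case 3
      then have "indicator {0..} (1/\<beta> * t) * (1/\<beta> * t) powr (3/2 - 1) / exp (1/\<beta> * t) =
          1 / sqrt \<beta> * (sqrt t * exp (- t / \<beta>))"
        using assms by (simp add: powr_half_sqrt real_sqrt_divide exp_minus field_simps)
      then have "?f (0 + 1/\<beta> * t) = ennreal (1 / sqrt \<beta> * (sqrt t * exp (- t / \<beta>)))"
        by (simp only: add_0)
      also have "\<dots> = ennreal (1 / sqrt \<beta>) * ennreal (sqrt t * exp (- t / \<beta>))"
        using 3 assms by (intro ennreal_mult) auto
      finally show ?thesis using 3 by (simp only: if_True)
    qed (use assms in \<open>auto simp: divide_less_0_iff not_le zero_le_divide_iff\<close>)
  qed
  also have "\<dots> = ennreal (1 / sqrt \<beta>) * ?I"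
    by (rule nn_integral_cmult) measurable
  finally have "ennreal (sqrt pi / 2) = ennreal (1/\<beta>) * (ennreal (1 / sqrt \<beta>) * ?I)"
    using assms by (simp add: Gam)
  then have "ennreal (\<beta> * sqrt \<beta>) * ennreal (sqrt pi / 2) = (ennreal (\<beta> * sqrt \<beta>) * (ennreal (1/\<beta>) * ennreal (1 / sqrt \<beta>))) * ?I"
    by (simp add: mult.assoc)
  also have "ennreal (\<beta> * sqrt \<beta>) * (ennreal (1/\<beta>) * ennreal (1 / sqrt \<beta>)) = 1"
    using assms by (simp add: ennreal_mult[symmetric] del: ennreal_1)
  finally show ?thesis using assms by (simp add: ennreal_mult[symmetric])
qed

lemma h4_nonneg: "0 \<le> h4 z"
  by (cases z) (auto simp: h4_def D4_def)

lemma measurable_h4 [measurable]: "h4 \<in> borel_measurable borel"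
proof -
  have "(\<lambda>z. if Q4 (fst z) (snd z) > 0 \<and> snd z > 1 then 3 / (2 * pi * sqrt (Q4 (fst z) (snd z))) else 0)
      \<in> borel_measurable (borel \<Otimes>\<^sub>M borel)"
    unfolding Q4_def by measurable
  also have "(\<lambda>z. if Q4 (fst z) (snd z) > 0 \<and> snd z > 1 then 3 / (2 * pi * sqrt (Q4 (fst z) (snd z))) else 0) = h4"
    by (auto simp: h4_def D4_def fun_eq_iff)
  finally show ?thesis by (simp add: borel_prod)
qed

text \<open>For fixed \<open>t\<close>, the pair \<open>(p, q)\<close> is an affine image of \<open>(s, k)\<close>. By homogeneity of the discriminant the
  dependence on \<open>t\<close> splits off as a factor \<open>t\<^sup>3\<^sup>/\<^sup>2 t\<^sup>2 / t\<^sup>3 = t\<^sup>1\<^sup>/\<^sup>2\<close>, so that the shape \<open>(s, k)\<close> is independent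
  of the size \<open>t\<close>.\<close>

lemma rescale_to_skewness_kurtosis:
  fixes t w :: real and A :: "(real \<times> real) set"
  assumes t: "t > 0" and w: "w \<ge> 0" and A [measurable]: "A \<in> sets borel"
  shows "(\<integral>\<^sup>+p. \<integral>\<^sup>+q. (if t > 0 \<and> q > 0 \<and> cubic_disc t q (p^2) > 0 then ennreal
      (w * indicator A (6 * p / t powr (3/2), (t^2 + 4 * q) / t^2) / (4 * sqrt (cubic_disc t q (p^2)))) else 0) \<partial>lborel \<partial>lborel)
    = ennreal (pi / 12 * (sqrt t * w)) * (\<integral>\<^sup>+s. \<integral>\<^sup>+k. ennreal (h4 (s, k)) * indicator A (s, k) \<partial>lborel \<partial>lborel)"
    (is "(\<integral>\<^sup>+p. \<integral>\<^sup>+q. ?g p q \<partial>lborel \<partial>lborel) = _")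
proof -
  have A' [measurable]: "A \<in> sets (borel \<Otimes>\<^sub>M borel)" unfolding borel_prod by (rule A)
  have h4' [measurable]: "h4 \<in> borel_measurable (borel \<Otimes>\<^sub>M borel)" using measurable_h4 by (simp add: borel_prod)
  define g where "g p q = ?g p q" for p q
  have gm [measurable]: "(\<lambda>z. g (f z) (h z)) \<in> borel_measurable M"
    if [measurable]: "f \<in> borel_measurable M" "h \<in> borel_measurable M" for f h and M :: "'z measure"
    unfolding g_def cubic_disc_def by measurable
  have tp: "t powr (3/2) = t * sqrt t"
  proof -
    have "t powr (3/2) = t powr (1 + 1/2)" by simp
    also have "\<dots> = t * sqrt t" using t by (subst powr_add) (simp add: powr_half_sqrt)
    finally show ?thesis .
  qed
  \<comment> \<open>\<open>p = \<alpha> s\<close> and \<open>q = \<gamma> (k - 1)\<close> solve \<open>s = 6p / t\<^sup>3\<^sup>/\<^sup>2\<close> and \<open>k = 1 + 4q / t\<^sup>2\<close>.\<close>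
  define \<alpha> \<gamma> where "\<alpha> = t * sqrt t / 6" and "\<gamma> = t^2 / 4"
  have pos: "\<alpha> > 0" "\<gamma> > 0" using t by (simp_all add: \<alpha>_def \<gamma>_def)
  have point: "ennreal \<alpha> * (ennreal \<gamma> * g (0 + \<alpha> * s) (-\<gamma> + \<gamma> * k)) =
      ennreal (pi / 12 * (sqrt t * w)) * (ennreal (h4 (s, k)) * indicator A (s, k))" for s k
  proof -
    have \<alpha>2: "(0 + \<alpha> * s)^2 = t^3 * (s^2 / 36)"
      using t by (simp add: \<alpha>_def power_mult_distrib power_divide power2_eq_square power3_eq_cube)
    have \<gamma>k: "-\<gamma> + \<gamma> * k = t^2 * ((k - 1) / 4)" by (simp add: \<gamma>_def field_simps)
    have disc: "cubic_disc t (-\<gamma> + \<gamma> * k) ((0 + \<alpha> * s)^2) = t^6 * (Q4 s k / 144)"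
      unfolding \<alpha>2 \<gamma>k cubic_disc_scale Q4_eq_cubic_disc by simp
    have sdisc: "sqrt (cubic_disc t (-\<gamma> + \<gamma> * k) ((0 + \<alpha> * s)^2)) = t^3 * sqrt (Q4 s k) / 12"
    proof -
      have "t^6 = (t^3)^2" by simp
      then have "sqrt (t^6) = t^3" using t by (metis less_imp_le real_sqrt_abs abs_of_nonneg zero_le_power)
      moreover have "sqrt (144::real) = 12" by (rule real_sqrt_unique) auto
      ultimately show ?thesis unfolding disc by (simp add: real_sqrt_mult real_sqrt_divide)
    qed
    have S: "6 * (0 + \<alpha> * s) / t powr (3/2) = s" using t by (simp add: tp \<alpha>_def)
    have K: "(t^2 + 4 * (-\<gamma> + \<gamma> * k)) / t^2 = k" using t by (simp add: \<gamma>_def field_simps)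
    have dom: "t > 0 \<and> -\<gamma> + \<gamma> * k > 0 \<and> cubic_disc t (-\<gamma> + \<gamma> * k) ((0 + \<alpha> * s)^2) > 0 \<longleftrightarrow> (s, k) \<in> D4"
    proof -
      have "-\<gamma> + \<gamma> * k > 0 \<longleftrightarrow> k > 1" unfolding \<gamma>k using t by (simp add: zero_less_mult_iff)
      moreover have "t^6 * (Q4 s k / 144) > 0 \<longleftrightarrow> Q4 s k > 0" using t by (simp add: zero_less_mult_iff)
      ultimately show ?thesis unfolding disc using t by (auto simp: D4_def)
    qed
    show ?thesis
    proof (cases "(s, k) \<in> D4")
      case True
      then have Q: "Q4 s k > 0" by (simp add: D4_def)
      have "\<alpha> * (\<gamma> * (w * x / (4 * (t^3 * sqrt (Q4 s k) / 12)))) = pi / 12 * (sqrt t * w) * (h4 (s, k) * x)" for x :: real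
        using True Q t by (simp add: h4_def \<alpha>_def \<gamma>_def field_simps power2_eq_square power3_eq_cube)
      note h4_scaled = this
      have ennreal_collect: "ennreal \<alpha> * (ennreal \<gamma> * ennreal x) = ennreal (\<alpha> * (\<gamma> * x))" if "x \<ge> 0" for x
        using that pos by (simp add: ennreal_mult)
      have g: "g (0 + \<alpha> * s) (-\<gamma> + \<gamma> * k) =
          ennreal (w * indicator A (s, k) / (4 * (t^3 * sqrt (Q4 s k) / 12)))"
        unfolding g_def dom sdisc S K by (simp only: True if_True)
      have g_nonneg: "w * indicator A (s, k) / (4 * (t^3 * sqrt (Q4 s k) / 12)) \<ge> 0"
        using w t Q by simp
      have "ennreal \<alpha> * (ennreal \<gamma> * g (0 + \<alpha> * s) (-\<gamma> + \<gamma> * k)) =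
          ennreal (pi / 12 * (sqrt t * w) * (h4 (s, k) * indicator A (s, k)))"
        unfolding g ennreal_collect[OF g_nonneg] h4_scaled ..
      also have "\<dots> = ennreal (pi / 12 * (sqrt t * w)) * ennreal (h4 (s, k) * indicator A (s, k))"
        using w t h4_nonneg by (intro ennreal_mult) auto
      also have "ennreal (h4 (s, k) * indicator A (s, k)) = ennreal (h4 (s, k)) * ennreal (indicator A (s, k))"
        using h4_nonneg by (intro ennreal_mult) auto
      finally show ?thesis unfolding ennreal_indicator .
    next
      case False
      then show ?thesis unfolding g_def dom by (simp add: h4_def)
    qed
  qed
  have "(\<integral>\<^sup>+p. \<integral>\<^sup>+q. g p q \<partial>lborel \<partial>lborel) = \<bar>\<alpha>\<bar> * (\<integral>\<^sup>+s. \<integral>\<^sup>+q. g (0 + \<alpha> * s) q \<partial>lborel \<partial>lborel)"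
    by (rule nn_integral_real_affine) (use pos in \<open>simp_all\<close>)
  also have "\<dots> = \<bar>\<alpha>\<bar> * (\<integral>\<^sup>+s. \<bar>\<gamma>\<bar> * (\<integral>\<^sup>+k. g (0 + \<alpha> * s) (-\<gamma> + \<gamma> * k) \<partial>lborel) \<partial>lborel)"
    by (intro arg_cong2[where f=times] refl nn_integral_cong nn_integral_real_affine) (use pos in \<open>simp_all\<close>)
  also have "\<dots> = (\<integral>\<^sup>+s. \<integral>\<^sup>+k. ennreal \<alpha> * (ennreal \<gamma> * g (0 + \<alpha> * s) (-\<gamma> + \<gamma> * k)) \<partial>lborel \<partial>lborel)"
    using pos by (simp add: nn_integral_cmult)
  also have "\<dots> = ennreal (pi / 12 * (sqrt t * w)) * (\<integral>\<^sup>+s. \<integral>\<^sup>+k. ennreal (h4 (s, k)) * indicator A (s, k) \<partial>lborel \<partial>lborel)"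
    unfolding point by (simp add: nn_integral_cmult)
  finally show ?thesis unfolding g_def .
qed

text \<open>The heart of the argument: fold the integral into one chamber, pass to the invariants
  \<open>(t, p, q)\<close>, rescale to \<open>(t, s, k)\<close>, and integrate out \<open>t\<close>.\<close>

lemma nn_integral_isotropic_shape:
  fixes A :: "(real \<times> real) set" and \<sigma> :: real
  assumes "\<sigma> > 0" and A [measurable]: "A \<in> sets borel"
  defines "w \<equiv> \<lambda>t. exp (- t / (2 * \<sigma>^2)) / sqrt (2 * pi * \<sigma>^2) ^ 3"
  defines "F \<equiv> \<lambda>t p q. w t * indicator A (6 * p / t powr (3/2), (t^2 + 4 * q) / t^2)"
  shows "(\<integral>\<^sup>+a. \<integral>\<^sup>+b. \<integral>\<^sup>+c. ennreal (F (a^2 + b^2 + c^2) (a*b*c) (a^2*b^2 + b^2*c^2 + c^2*a^2))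
      \<partial>lborel \<partial>lborel \<partial>lborel) = (\<integral>\<^sup>+z. ennreal (h4 z) * indicator A z \<partial>lborel)"
proof -
  have A' [measurable]: "A \<in> sets (borel \<Otimes>\<^sub>M borel)" unfolding borel_prod by (rule A)
  have [measurable]: "(\<lambda>z. F (f z) (g z) (h z)) \<in> borel_measurable M"
    if [measurable]: "f \<in> borel_measurable M" "g \<in> borel_measurable M" "h \<in> borel_measurable M"
    for f g h and M :: "'z measure"
    unfolding F_def w_def by measurable
  have w: "w t \<ge> 0" for t by (simp add: w_def)
  define J where "J = (\<integral>\<^sup>+s. \<integral>\<^sup>+k. ennreal (h4 (s, k)) * indicator A (s, k) \<partial>lborel \<partial>lborel)"
  define \<beta> where "\<beta> = 2 * \<sigma>^2"
  have \<beta>: "\<beta> > 0" using assms(1) by (simp add: \<beta>_def)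
  define C where "C = pi / 12 / sqrt (pi * \<beta>) ^ 3"
  have wC: "pi / 12 * (sqrt t * w t) = C * (sqrt t * exp (- t / \<beta>))" for t
    by (simp add: C_def w_def \<beta>_def mult_ac)
  have C: "C \<ge> 0" using \<beta> by (simp add: C_def)
  \<comment> \<open>The 24 chambers, the factor from the rescaling, and the radial integral cancel exactly; this is
    where the constant \<open>3 / (2\<pi>)\<close> in the density is confirmed.\<close>
  have const: "24 * (ennreal C * ennreal (\<beta> * sqrt \<beta> * sqrt pi / 2)) = 1"
  proof -
    have "sqrt (pi * \<beta>) ^ 3 = (sqrt (pi * \<beta>))^2 * sqrt (pi * \<beta>)"
      by (simp add: power3_eq_cube power2_eq_square)
    also have "\<dots> = pi * (\<beta> * sqrt \<beta> * sqrt pi)"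
      using \<beta> by (simp add: real_sqrt_mult power_mult_distrib)
    finally have "24 * (C * (\<beta> * sqrt \<beta> * sqrt pi / 2)) = 1"
      using \<beta> by (simp add: C_def)
    moreover have "ennreal (24 * (C * v)) = 24 * (ennreal C * ennreal v)" if "v \<ge> 0" for v
      using C that by (simp add: ennreal_mult)
    ultimately show ?thesis using \<beta> by (metis ennreal_1 half_gt_zero less_imp_le mult_pos_pos pi_gt_zero real_sqrt_gt_zero)
  qed
  have "(\<integral>\<^sup>+a. \<integral>\<^sup>+b. \<integral>\<^sup>+c. ennreal (F (a^2 + b^2 + c^2) (a*b*c) (a^2*b^2 + b^2*c^2 + c^2*a^2))
      \<partial>lborel \<partial>lborel \<partial>lborel) =
    24 * (\<integral>\<^sup>+a. \<integral>\<^sup>+b. \<integral>\<^sup>+c. (if a > b \<and> b > \<bar>c\<bar> then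
      ennreal (F (a^2 + b^2 + c^2) (a*b*c) (a^2*b^2 + b^2*c^2 + c^2*a^2)) else 0) \<partial>lborel \<partial>lborel \<partial>lborel)"
  proof (rule nn_integral_tetrahedral_symmetry)
    show "(\<lambda>(a, b, c). ennreal (F (a^2 + b^2 + c^2) (a*b*c) (a^2*b^2 + b^2*c^2 + c^2*a^2))) \<in> borel_measurable borel"
      unfolding borel_prod[symmetric] by measurable
  qed (simp_all add: ac_simps)
  also have "(\<integral>\<^sup>+a. \<integral>\<^sup>+b. \<integral>\<^sup>+c. (if a > b \<and> b > \<bar>c\<bar> then
      ennreal (F (a^2 + b^2 + c^2) (a*b*c) (a^2*b^2 + b^2*c^2 + c^2*a^2)) else 0) \<partial>lborel \<partial>lborel \<partial>lborel) =
    (\<integral>\<^sup>+t. \<integral>\<^sup>+p. \<integral>\<^sup>+q. (if t > 0 \<and> q > 0 \<and> cubic_disc t q (p^2) > 0 then ennreal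
            (F t p q / (4 * sqrt (cubic_disc t q (p^2)))) else 0) \<partial>lborel \<partial>lborel \<partial>lborel)"
  proof (rule nn_integral_invariants)
    show "(\<lambda>(t, p, q). F t p q) \<in> borel_measurable borel"
      unfolding borel_prod[symmetric] by measurable
  qed (simp add: F_def w)
  also have "\<dots> = (\<integral>\<^sup>+t. ennreal C * (if t > 0 then ennreal (sqrt t * exp (- t / \<beta>)) else 0) * J \<partial>lborel)"
  proof (rule nn_integral_cong)
    fix t :: real
    show "(\<integral>\<^sup>+p. \<integral>\<^sup>+q. (if t > 0 \<and> q > 0 \<and> cubic_disc t q (p^2) > 0 then ennreal
            (F t p q / (4 * sqrt (cubic_disc t q (p^2)))) else 0) \<partial>lborel \<partial>lborel) =
        ennreal C * (if t > 0 then ennreal (sqrt t * exp (- t / \<beta>)) else 0) * J"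
    proof (cases "t > 0")
      case True
      then have "ennreal (C * (sqrt t * exp (- t / \<beta>))) = ennreal C * ennreal (sqrt t * exp (- t / \<beta>))"
        using C by (intro ennreal_mult) auto
      then show ?thesis
        using True rescale_to_skewness_kurtosis[OF True w[of t] A] unfolding F_def J_def[symmetric] wC
        by simp
    qed simp
  qed
  also have "\<dots> = ennreal C * ennreal (\<beta> * sqrt \<beta> * sqrt pi / 2) * J"
    by (simp add: nn_integral_multc nn_integral_cmult nn_integral_radial[OF \<beta>])
  also have "24 * (ennreal C * ennreal (\<beta> * sqrt \<beta> * sqrt pi / 2) * J) = J"
    by (subst mult.assoc[symmetric], subst const) simp
  also have "J = (\<integral>\<^sup>+z. ennreal (h4 z) * indicator A z \<partial>(lborel \<Otimes>\<^sub>M lborel))"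
    unfolding J_def by (rule lborel.nn_integral_fst) (simp add: lborel_prod)
  finally show ?thesis by (simp add: lborel_prod)
qed

lemma nn_integral_sample_shape:
  fixes M :: "'a measure" and X :: "nat \<Rightarrow> 'a \<Rightarrow> real"
  assumes "prob_space M" and \<sigma>: "\<sigma> > 0"
    and indep: "prob_space.indep_vars M (\<lambda>_. borel) X {1..4}"
    and X: "\<And>i. i \<in> {1..4} \<Longrightarrow> distributed M lborel (X i) (\<lambda>x. ennreal (normal_density \<mu> \<sigma> x))"
    and A [measurable]: "A \<in> sets borel"
  shows "(\<integral>\<^sup>+\<omega>. indicator A (sample_skewness 4 (\<lambda>i. X i \<omega>), sample_kurtosis 4 (\<lambda>i. X i \<omega>)) \<partial>M) =
    (\<integral>\<^sup>+z. ennreal (h4 z) * indicator A z \<partial>lborel)"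
proof -
  have A' [measurable]: "A \<in> sets (borel \<Otimes>\<^sub>M borel)" unfolding borel_prod by (rule A)
  define w where "w t = exp (- t / (2 * \<sigma>^2)) / sqrt (2 * pi * \<sigma>^2) ^ 3" for t
  have w: "w t \<ge> 0" for t by (simp add: w_def)
  define G :: "real \<Rightarrow> real \<Rightarrow> real \<Rightarrow> real" where
    "G a b c = indicator A (6 * (a*b*c) / (a^2 + b^2 + c^2) powr (3/2),
      ((a^2 + b^2 + c^2)^2 + 4 * (a^2*b^2 + b^2*c^2 + c^2*a^2)) / (a^2 + b^2 + c^2)^2)" for a b c
  have [measurable]: "(\<lambda>z. G (f z) (g z) (h z)) \<in> borel_measurable M"
    if [measurable]: "f \<in> borel_measurable M" "g \<in> borel_measurable M" "h \<in> borel_measurable M"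
    for f g h and M :: "'z measure"
    unfolding G_def by measurable
  define H where "H x1 x2 x3 x4 = ennreal (G ((x1 + x2 - x3 - x4) / 2) ((x1 - x2 + x3 - x4) / 2) ((x1 - x2 - x3 + x4) / 2))"
    for x1 x2 x3 x4
  have [measurable]: "(\<lambda>z. H (f z) (g z) (h z) (k z)) \<in> borel_measurable M"
    if [measurable]: "f \<in> borel_measurable M" "g \<in> borel_measurable M" "h \<in> borel_measurable M"
      "k \<in> borel_measurable M" for f g h k and M :: "'z measure"
    unfolding H_def by measurable
  let ?\<phi> = "normal_density \<mu> \<sigma>"
  have "(\<integral>\<^sup>+\<omega>. indicator A (sample_skewness 4 (\<lambda>i. X i \<omega>), sample_kurtosis 4 (\<lambda>i. X i \<omega>)) \<partial>M) =
      (\<integral>\<^sup>+\<omega>. H (X 1 \<omega>) (X 2 \<omega>) (X 3 \<omega>) (X 4 \<omega>) \<partial>M)"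
    unfolding sample_shape_in_Hadamard_coordinates H_def G_def ennreal_indicator ..
  also have "\<dots> = (\<integral>\<^sup>+x1. \<integral>\<^sup>+x2. \<integral>\<^sup>+x3. \<integral>\<^sup>+x4. ennreal (?\<phi> x1) * ennreal (?\<phi> x2) * ennreal (?\<phi> x3) * ennreal (?\<phi> x4)
       * H x1 x2 x3 x4 \<partial>lborel \<partial>lborel \<partial>lborel \<partial>lborel)"
    by (rule nn_integral_iid4[OF assms(1) indep X]) (simp, unfold borel_prod[symmetric], measurable)
  also have "\<dots> = (\<integral>\<^sup>+m. \<integral>\<^sup>+a. \<integral>\<^sup>+b. \<integral>\<^sup>+c. ennreal (?\<phi> ((m+a+b+c)/2)) * ennreal (?\<phi> ((m+a-b-c)/2)) *
       ennreal (?\<phi> ((m-a+b-c)/2)) * ennreal (?\<phi> ((m-a-b+c)/2))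
       * H ((m+a+b+c)/2) ((m+a-b-c)/2) ((m-a+b-c)/2) ((m-a-b+c)/2) \<partial>lborel \<partial>lborel \<partial>lborel \<partial>lborel)"
    by (rule nn_integral_Hadamard) (unfold borel_prod[symmetric], measurable)
  also have "\<dots> = (\<integral>\<^sup>+m. \<integral>\<^sup>+a. \<integral>\<^sup>+b. \<integral>\<^sup>+c. ennreal (normal_density (2 * \<mu>) \<sigma> m) *
      ennreal (w (a^2 + b^2 + c^2) * G a b c) \<partial>lborel \<partial>lborel \<partial>lborel \<partial>lborel)"
  proof (intro nn_integral_cong)
    fix m a b c :: real
    have "((m+a+b+c)/2 + (m+a-b-c)/2 - (m-a+b-c)/2 - (m-a-b+c)/2) / 2 = a"
      "((m+a+b+c)/2 - (m+a-b-c)/2 + (m-a+b-c)/2 - (m-a-b+c)/2) / 2 = b"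
      "((m+a+b+c)/2 - (m+a-b-c)/2 - (m-a+b-c)/2 + (m-a-b+c)/2) / 2 = c"
      by (simp_all add: field_simps)
    then have "H ((m+a+b+c)/2) ((m+a-b-c)/2) ((m-a+b-c)/2) ((m-a-b+c)/2) = ennreal (G a b c)"
      by (simp only: H_def)
    moreover have "ennreal (?\<phi> ((m+a+b+c)/2)) * ennreal (?\<phi> ((m+a-b-c)/2)) *
       ennreal (?\<phi> ((m-a+b-c)/2)) * ennreal (?\<phi> ((m-a-b+c)/2)) =
       ennreal (normal_density (2 * \<mu>) \<sigma> m) * ennreal (w (a^2 + b^2 + c^2))"
      unfolding w_def by (simp only: ennreal_mult'[symmetric] normal_density_nonneg mult_nonneg_nonneg normal_density_Hadamard[OF \<sigma>])
    moreover have "ennreal (w (a^2 + b^2 + c^2) * G a b c) = ennreal (w (a^2 + b^2 + c^2)) * ennreal (G a b c)"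
      by (rule ennreal_mult') (rule w)
    ultimately show "ennreal (?\<phi> ((m+a+b+c)/2)) * ennreal (?\<phi> ((m+a-b-c)/2)) *
       ennreal (?\<phi> ((m-a+b-c)/2)) * ennreal (?\<phi> ((m-a-b+c)/2))
       * H ((m+a+b+c)/2) ((m+a-b-c)/2) ((m-a+b-c)/2) ((m-a-b+c)/2) =
       ennreal (normal_density (2 * \<mu>) \<sigma> m) * ennreal (w (a^2 + b^2 + c^2) * G a b c)"
      by (simp only: mult.assoc)
  qed
  also have "\<dots> = (\<integral>\<^sup>+m. ennreal (normal_density (2 * \<mu>) \<sigma> m) \<partial>lborel) *
      (\<integral>\<^sup>+a. \<integral>\<^sup>+b. \<integral>\<^sup>+c. ennreal (w (a^2 + b^2 + c^2) * G a b c) \<partial>lborel \<partial>lborel \<partial>lborel)"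
    unfolding w_def by (simp add: nn_integral_cmult nn_integral_multc)
  also have "(\<integral>\<^sup>+m. ennreal (normal_density (2 * \<mu>) \<sigma> m) \<partial>lborel) = 1"
    using \<sigma> by (subst nn_integral_eq_integral) auto
  also have "(\<integral>\<^sup>+a. \<integral>\<^sup>+b. \<integral>\<^sup>+c. ennreal (w (a^2 + b^2 + c^2) * G a b c) \<partial>lborel \<partial>lborel \<partial>lborel) =
     (\<integral>\<^sup>+z. ennreal (h4 z) * indicator A z \<partial>lborel)"
    unfolding w_def G_def by (rule nn_integral_isotropic_shape[OF \<sigma> A])
  finally show ?thesis by simp
qed

section \<open>Support and density\<close>

text \<open>A nonempty open set is not Lebesgue null, so a density that is positive on it gives it positive mass.\<close>

lemma measure_support_density:
  fixes f :: "'a::euclidean_space \<Rightarrow> real"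
  assumes [measurable]: "f \<in> borel_measurable borel" and D: "open D"
    and pos: "\<And>x. x \<in> D \<Longrightarrow> f x > 0" and zero: "\<And>x. x \<notin> D \<Longrightarrow> f x = 0"
  shows "measure_support (density lborel (\<lambda>x. ennreal (f x))) = closure D"
proof (intro equalityI subsetI)
  let ?N = "density lborel (\<lambda>x. ennreal (f x))"
  fix x assume x: "x \<in> measure_support ?N"
  show "x \<in> closure D"
  proof (rule ccontr)
    assume "x \<notin> closure D"
    moreover have "open (- closure D)" by (intro open_Compl closed_closure)
    ultimately have "emeasure ?N (- closure D) > 0"
      using x unfolding measure_support_def by blast
    moreover have "emeasure ?N (- closure D) = (\<integral>\<^sup>+y. ennreal (f y) * indicator (- closure D) y \<partial>lborel)"
      by (rule emeasure_density) auto
    moreover have "\<dots> = (\<integral>\<^sup>+y. 0 \<partial>(lborel :: 'a measure))"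
      by (intro nn_integral_cong) (use closure_subset[of D] zero in \<open>fastforce simp: indicator_def\<close>)
    ultimately show False by simp
  qed
next
  let ?N = "density lborel (\<lambda>x. ennreal (f x))"
  fix x assume x: "x \<in> closure D"
  have "emeasure ?N U > 0" if U: "open U" "x \<in> U" for U
  proof -
    have "open (U \<inter> D)" "U \<inter> D \<noteq> {}"
      using U D x by (auto simp: open_Int closure_iff_nhds_not_empty)
    then have not_null: "U \<inter> D \<notin> null_sets lborel"
      using open_not_negligible[of "U \<inter> D"] by (auto simp: negligible_iff_null_sets intro: null_sets_completionI)
    have [measurable]: "U \<in> sets borel" using U by simp
    have "emeasure ?N U \<noteq> 0"
    proof
      assume "emeasure ?N U = 0"
      then have "U \<in> null_sets ?N" by (intro null_setsI) auto
      then have "AE y in lborel. y \<in> U \<longrightarrow> ennreal (f y) = 0"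
        by (simp add: null_sets_density_iff)
      then have "AE y in lborel. y \<notin> U \<inter> D"
        by eventually_elim (use pos in \<open>force simp: ennreal_eq_0_iff\<close>)
      then have "U \<inter> D \<in> null_sets lborel"
        using U D by (subst AE_iff_null_sets) (auto intro: borel_open)
      with not_null show False ..
    qed
    then show ?thesis by (simp add: zero_less_iff_neq_zero)
  qed
  then show "x \<in> measure_support ?N" by (simp add: measure_support_def)
qed

lemma open_D4: "open D4"
proof -
  have "D4 = {z. Q4 (fst z) (snd z) > 0} \<inter> {z. snd z > 1}" by (auto simp: D4_def)
  also have "open \<dots>"
    unfolding Q4_def by (intro open_Int open_Collect_less continuous_intros)
  finally show ?thesis .
qed

theorem theorem4:
  fixes M :: "'a measure" and X :: "nat \<Rightarrow> 'a \<Rightarrow> real" and \<mu> \<sigma> :: real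
  assumes "prob_space M"
    and "\<sigma> > 0"
    and "prob_space.indep_vars M (\<lambda>_. borel) X {1..4}"
    and "\<And>i. i \<in> {1..4} \<Longrightarrow> distributed M lborel (X i) (\<lambda>x. ennreal (normal_density \<mu> \<sigma> x))"
  defines "S \<equiv> \<lambda>\<omega>. sample_skewness 4 (\<lambda>i. X i \<omega>)"
    and "K \<equiv> \<lambda>\<omega>. sample_kurtosis 4 (\<lambda>i. X i \<omega>)"
  shows "measure_support (distr M borel (\<lambda>\<omega>. (S \<omega>, K \<omega>))) = closure D4
    \<and> distributed M lborel (\<lambda>\<omega>. (S \<omega>, K \<omega>)) (\<lambda>z. ennreal (h4 z))"
proof -
  have Xm [measurable]: "X i \<in> borel_measurable M" if "i \<in> {1..4}" for i
    using assms(4)[OF that] by (auto simp: distributed_def)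
  have "X 1 \<in> borel_measurable M" "X 2 \<in> borel_measurable M" "X 3 \<in> borel_measurable M" "X 4 \<in> borel_measurable M"
    by (auto intro: Xm)
  note [measurable] = this
  have SK [measurable]: "(\<lambda>\<omega>. (S \<omega>, K \<omega>)) \<in> borel_measurable M"
    unfolding S_def K_def sample_shape_in_Hadamard_coordinates borel_prod[symmetric] by measurable
  have law: "distr M borel (\<lambda>\<omega>. (S \<omega>, K \<omega>)) = density lborel (\<lambda>z. ennreal (h4 z))"
  proof (rule measure_eqI)
    fix A assume "A \<in> sets (distr M borel (\<lambda>\<omega>. (S \<omega>, K \<omega>)))"
    then have A [measurable]: "A \<in> sets borel" by simp
    have "emeasure (distr M borel (\<lambda>\<omega>. (S \<omega>, K \<omega>))) A = (\<integral>\<^sup>+z. indicator A z \<partial>distr M borel (\<lambda>\<omega>. (S \<omega>, K \<omega>)))"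
      by simp
    also have "\<dots> = (\<integral>\<^sup>+\<omega>. indicator A (S \<omega>, K \<omega>) \<partial>M)"
      by (rule nn_integral_distr) measurable
    also have "\<dots> = (\<integral>\<^sup>+z. ennreal (h4 z) * indicator A z \<partial>lborel)"
      unfolding S_def K_def by (rule nn_integral_sample_shape[OF assms(1-4) A])
    also have "\<dots> = emeasure (density lborel (\<lambda>z. ennreal (h4 z))) A"
      by (rule emeasure_density[symmetric]) auto
    finally show "emeasure (distr M borel (\<lambda>\<omega>. (S \<omega>, K \<omega>))) A = emeasure (density lborel (\<lambda>z. ennreal (h4 z))) A" .
  qed simp
  have "measure_support (distr M borel (\<lambda>\<omega>. (S \<omega>, K \<omega>))) = closure D4"
    unfolding law
  proof (rule measure_support_density[OF measurable_h4 open_D4])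
    show "h4 z > 0" if "z \<in> D4" for z
      using that by (cases z) (auto simp: h4_def D4_def)
    show "h4 z = 0" if "z \<notin> D4" for z
      using that by (cases z) (auto simp: h4_def)
  qed
  moreover have "distr M lborel (\<lambda>\<omega>. (S \<omega>, K \<omega>)) = distr M borel (\<lambda>\<omega>. (S \<omega>, K \<omega>))"
    by (rule distr_cong) auto
  ultimately show ?thesis
    using law by (simp add: distributed_def)
qed

end
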